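(* Let $a_1,a_2,b_1,b_2,\alpha,\beta,\lambda\in\mathbb{C}$ with $\lambda\neq 0$ and $\varepsilon_0:=a_1b_2-a_2b_1\neq 0$. For $x=(x^1,x^2,x^3,x^4)\in\mathbb{R}^4$ put $$L=\tfrac{1}{\sqrt2}\big[(\lambda\alpha+\beta)x^1+i(\lambda\alpha-\beta)x^2+(\lambda\beta-\alpha)x^3+i(\lambda\beta+\alpha)x^4\big],$$ $$\psi=\begin{pmatrix} a_1e^{L}+a_2e^{-L} & \overline{b}_1e^{\overline L}+\overline b_2e^{-\overline L}\\ -b_1e^{L}-b_2e^{-L} & \overline a_1e^{\overline L}+\overline a_2e^{-\overline L}\end{pmatrix},\quad \Lambda=\begin{pmatrix}\lambda&0\\0&-1/\overline\lambda\end{pmatrix},\quad J=-\psi\Lambda\psi^{-1},$$ and $$A_1=-\tfrac12\big[(\partial_1J)J^{-1}-i(\partial_2J)J^{-1}\big],\quad A_2=iA_1,\quad A_3=-\tfrac12\big[(\partial_3J)J^{-1}-i(\partial_4J)J^{-1}\big],\quad A_4=iA_3.$$ Then the gauge fields $A_\mu$ satisfy the anti-self-dual Yang-Mills equations for the Euclidean metric and are traceless (gauge group $\mathrm{SL}(2,\mathbb{C})$); and the Lagrangian density is real-valued, well defined on $\mathbb{R}^4$, and equal to $$\mathrm{Tr}\,F_{\mu\nu}F^{\mu\nu}=8\big[(|\alpha|^2+|\beta|^2)(|\lambda|^2+1)|\varepsilon_0|\big]^2\;\frac{2\varepsilon_1\widetilde\varepsilon_1\sinh^2X_1-2|\varepsilon_2|^2\sinh^2X_2-|\varepsilon_0|^2}{\big[(\varepsilon_1\widetilde\varepsilon_1)^{1/2}\cosh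 X_1+|\varepsilon_2|\cosh X_2\big]^4},$$ where $\varepsilon_1=|a_1|^2+|b_1|^2$, $\widetilde\varepsilon_1=|a_2|^2+|b_2|^2$, $\varepsilon_2=a_1\overline a_2+b_1\overline b_2$, $X_1=\overline L+L+\frac12\log(\varepsilon_1/\widetilde\varepsilon_1)$ and $X_2=\overline L-L+\frac12\log(\varepsilon_2/\overline\varepsilon_2)$. If $\varepsilon_2=0$, the part containing $X_2$ is removed and $$\mathrm{Tr}\,F_{\mu\nu}F^{\mu\nu}=8\big[(|\alpha|^2+|\beta|^2)(|\lambda|^2+1)\big]^2(2\,\mathrm{sech}^2X-3\,\mathrm{sech}^4X),\qquad X=L+\overline L+\tfrac12\log\frac{|a_1|^2+|b_1|^2}{|a_2|^2+|b_2|^2}.$$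
   Context: $\partial_\mu=\partial/\partial x^\mu$. $\mathbb{R}^4$ carries the Euclidean metric, repeated indices are summed, and $F_{\mu\nu}=\partial_\mu A_\nu-\partial_\nu A_\mu+[A_\mu,A_\nu]$; the gauge fields are $2\times2$ complex matrix valued. With $z=(x^1+ix^2)/\sqrt2$, $\widetilde z=\overline z$, $w=(x^3+ix^4)/\sqrt2$, $\widetilde w=-\overline w$ (so $ds^2=2(dz\,d\widetilde z-dw\,d\widetilde w)$), the anti-self-dual Yang-Mills equations are $F_{zw}=0$, $F_{\widetilde z\widetilde w}=0$, $F_{z\widetilde z}-F_{w\widetilde w}=0$, where the components are obtained by (complex-linear) change of coordinates from $F_{\mu\nu}$. In these coordinates $L=\lambda\alpha z+\beta\widetilde z+\lambda\beta w+\alpha\widetilde w$, and the gauge fields above are $A_z=-(\partial_zJ)J^{-1}$, $A_w=-(\partial_wJ)J^{-1}$, $A_{\widetilde z}=A_{\widetilde w}=0$.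
   Formalization: The printed X_2 = conj(L) − L + ½log(ε_2/conj ε_2) makes the density formula false in general; the formal statement uses X_2 = L − conj(L) + ½log(ε_2/conj ε_2), with half the logarithm read as i·arg ε_2. *)

theory Defs
  imports "HOL-Analysis.Analysis"
begin

text \<open>The index type \<^typ>\<open>4\<close> has the elements \<open>1, 2, 3, 4\<close>, where \<open>4\<close> coincides with \<open>0\<close>.\<close>

definition partial_deriv :: "4 \<Rightarrow> (real^4 \<Rightarrow> 'a::real_normed_vector) \<Rightarrow> real^4 \<Rightarrow> 'a" where
  "partial_deriv \<mu> f x = vector_derivative (\<lambda>t. f (x + t *\<^sub>R axis \<mu> 1)) (at 0)"

definition smult_mat :: "complex \<Rightarrow> complex^2^2 \<Rightarrow> complex^2^2" (infixr "*\<^sub>m" 75) where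
  "c *\<^sub>m M = (\<chi> i j. c * M $ i $ j)"

definition mat2 :: "complex \<Rightarrow> complex \<Rightarrow> complex \<Rightarrow> complex \<Rightarrow> complex^2^2" where
  "mat2 a b c d = vector [vector [a, b], vector [c, d]]"

type_synonym gauge_field = "4 \<Rightarrow> real^4 \<Rightarrow> complex^2^2"

definition field_strength :: "gauge_field \<Rightarrow> 4 \<Rightarrow> 4 \<Rightarrow> real^4 \<Rightarrow> complex^2^2" where
  "field_strength A \<mu> \<nu> x =
     partial_deriv \<mu> (A \<nu>) x - partial_deriv \<nu> (A \<mu>) x + (A \<mu> x ** A \<nu> x - A \<nu> x ** A \<mu> x)"

text \<open>The metric is Euclidean, so raising the indices of the field strength does not change it.
  Both indices run over all four values.\<close>

definition lagrangian_density :: "gauge_field \<Rightarrow> real^4 \<Rightarrow> complex" where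
  "lagrangian_density A x =
     (\<Sum>\<mu>\<in>UNIV. \<Sum>\<nu>\<in>UNIV. trace (field_strength A \<mu> \<nu> x ** field_strength A \<mu> \<nu> x))"

text \<open>The complex-linear extensions to \<open>\<complex>\<^sup>4\<close> of the coordinates \<open>z\<close>, \<open>z~\<close>, \<open>w\<close>, \<open>w~\<close>;
  on real points \<open>z~\<close> is the conjugate of \<open>z\<close>, and \<open>w~\<close> is minus the conjugate of \<open>w\<close>.\<close>

definition coord_z :: "complex^4 \<Rightarrow> complex" where
  "coord_z X = (X$1 + \<i> * X$2) / complex_of_real (sqrt 2)"

definition coord_zt :: "complex^4 \<Rightarrow> complex" where
  "coord_zt X = (X$1 - \<i> * X$2) / complex_of_real (sqrt 2)"

definition coord_w :: "complex^4 \<Rightarrow> complex" where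
  "coord_w X = (X$3 + \<i> * X$4) / complex_of_real (sqrt 2)"

definition coord_wt :: "complex^4 \<Rightarrow> complex" where
  "coord_wt X = - (X$3 - \<i> * X$4) / complex_of_real (sqrt 2)"

text \<open>The coordinate vector fields of these coordinates: entry \<open>\<mu>\<close> of \<open>frame_z\<close> is the partial
  derivative of \<open>x\<^sup>\<mu>\<close> with respect to \<open>z\<close>, and similarly for the others
  (see \<open>frame_expansion\<close> below).\<close>

definition frame_z :: "complex^4" where
  "frame_z = (1 / complex_of_real (sqrt 2)) *s vector [1, - \<i>, 0, 0]"

definition frame_zt :: "complex^4" where
  "frame_zt = (1 / complex_of_real (sqrt 2)) *s vector [1, \<i>, 0, 0]"

definition frame_w :: "complex^4" where
  "frame_w = (1 / complex_of_real (sqrt 2)) *s vector [0, 0, 1, - \<i>]"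

definition frame_wt :: "complex^4" where
  "frame_wt = (1 / complex_of_real (sqrt 2)) *s vector [0, 0, - 1, - \<i>]"

lemma vector4_nth:
  "(vector [a, b, c, d] :: ('a::zero)^4) $ 1 = a"
  "(vector [a, b, c, d] :: 'a^4) $ 2 = b"
  "(vector [a, b, c, d] :: 'a^4) $ 3 = c"
  "(vector [a, b, c, d] :: 'a^4) $ 4 = d"
  by (simp_all add: vector_def)

lemma frame_expansion:
  "X = coord_z X *s frame_z + coord_zt X *s frame_zt + coord_w X *s frame_w + coord_wt X *s frame_wt"
proof -
  have s: "complex_of_real (sqrt 2) * complex_of_real (sqrt 2) = 2"
    by (metis of_real_mult of_real_numeral real_sqrt_mult_self abs_numeral)
  show ?thesis
    unfolding vec_eq_iff forall_4
    by (simp add: coord_z_def coord_zt_def coord_w_def coord_wt_def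
        frame_z_def frame_zt_def frame_w_def frame_wt_def vector4_nth s
        diff_divide_distrib add_divide_distrib algebra_simps)
qed

definition component ::
  "gauge_field \<Rightarrow> complex^4 \<Rightarrow> complex^4 \<Rightarrow> real^4 \<Rightarrow> complex^2^2" where
  "component A u v x = (\<Sum>\<mu>\<in>UNIV. \<Sum>\<nu>\<in>UNIV. (u$\<mu> * v$\<nu>) *\<^sub>m field_strength A \<mu> \<nu> x)"

definition anti_self_dual_YM :: "gauge_field \<Rightarrow> bool" where
  "anti_self_dual_YM A \<longleftrightarrow> (\<forall>x.
     component A frame_z frame_w x = 0 \<and>
     component A frame_zt frame_wt x = 0 \<and>
     component A frame_z frame_zt x - component A frame_w frame_wt x = 0)"

text \<open>A value of \<open>log (e / cnj e)\<close> for \<open>e \<noteq> 0\<close>. The principal value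
  \<^term>\<open>Ln (e / cnj e)\<close> is unsuitable: for \<open>Re e < 0\<close> its half differs from \<open>\<i> Arg e\<close> by
  an odd multiple of \<open>\<i> \<pi>\<close>, which changes the sign of \<open>cosh X\<^sub>2\<close> for
  \<open>X\<^sub>2 = L - cnj L + log (e / cnj e) / 2\<close>. Hence
  \<open>log (cnj e)\<close> is read as the conjugate of \<open>log e\<close>.\<close>

definition log_ratio_cnj :: "complex \<Rightarrow> complex" where
  "log_ratio_cnj e = Ln e - cnj (Ln e)"

lemma exp_log_ratio_cnj: "e \<noteq> 0 \<Longrightarrow> exp (log_ratio_cnj e) = e / cnj e"
  by (simp add: log_ratio_cnj_def exp_diff flip: exp_cnj)

lemma exp_half_log_ratio_cnj:
  assumes "e \<noteq> 0"
  shows "exp (log_ratio_cnj e / 2) = e / complex_of_real (cmod e)"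
proof -
  have "log_ratio_cnj e / 2 = Ln e - complex_of_real (Re (Ln e))"
    by (simp add: log_ratio_cnj_def complex_eq_iff)
  then have "exp (log_ratio_cnj e / 2) = exp (Ln e - complex_of_real (Re (Ln e)))"
    by (rule arg_cong)
  also have "\<dots> = e / complex_of_real (cmod e)"
    using assms by (simp add: exp_diff exp_of_real)
  finally show ?thesis .
qed

end

(* Write psi = ((p, conj q), (- q, conj p)) with p, q combinations of exp L and exp (- L). Then J is a
   combination of the identity and the orthogonal projection P onto the line of (p, - q), so it depends
   on x only through L and conj L. Let R and S be the derivatives of P in L and conj L. The Wronskian of
   p and q is constant, which gives R and S in closed form: they are nilpotent, d_L R is a multiple of R,
   and the mixed derivative d_L S = d_(conj L) R is the commutator [R, S] = Q. Moreover R P = R and S P = 0,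
   so A_mu = c_mu R + d_mu S with constant vectors c, d, and F_mu_nu is a combination of R, Q and S
   whose coefficients are 2-forms with constant coefficients, up to the logarithmic derivatives of
   D = |p|^2 + |q|^2. Anti-self-duality and the density then reduce to a few dot products of c, d, the
   gradient k of L and conj k, and to tr(R S) = 4 |eps0|^2 / D^2. *)

theory Submission
  imports Defs
begin

section \<open>Two-by-two matrices\<close>

lemma mat2_nth [simp]:
  "mat2 a b c d $ 1 $ 1 = a" "mat2 a b c d $ 1 $ 2 = b"
  "mat2 a b c d $ 2 $ 1 = c" "mat2 a b c d $ 2 $ 2 = d"
  by (simp_all add: mat2_def)

lemma smult_mat_nth [simp]: "(c *\<^sub>m M) $ i $ j = c * M $ i $ j"
  by (simp add: smult_mat_def)

lemma matrix2_eq_iff: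
  "(M :: 'a^2^2) = N \<longleftrightarrow> M$1$1 = N$1$1 \<and> M$1$2 = N$1$2 \<and> M$2$1 = N$2$1 \<and> M$2$2 = N$2$2"
  by (auto simp: vec_eq_iff forall_2)

lemma matrix2_mult_nth: "((M :: 'a::semiring_1^2^2) ** N) $ i $ j = M$i$1 * N$1$j + M$i$2 * N$2$j"
  by (simp add: matrix_matrix_mult_def sum_2)

lemma mat_nth_2 [simp]:
  "(mat k :: 'a::zero^2^2) $ 1 $ 1 = k" "(mat k :: 'a^2^2) $ 1 $ 2 = 0"
  "(mat k :: 'a^2^2) $ 2 $ 1 = 0" "(mat k :: 'a^2^2) $ 2 $ 2 = k"
  by (simp_all add: mat_def)

lemma trace_2: "trace (M :: 'a::comm_semiring_1^2^2) = M$1$1 + M$2$2"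
  by (simp add: trace_def sum_2)

lemma matrix_inv_eqI:
  fixes M N :: "'a::semiring_1^'n^'n"
  assumes "M ** N = mat 1" "N ** M = mat 1"
  shows "matrix_inv M = N"
proof -
  have "M ** matrix_inv M = mat 1 \<and> matrix_inv M ** M = mat 1"
    unfolding matrix_inv_def using assms by (metis (mono_tags, lifting) someI_ex)
  then have "matrix_inv M = (N ** M) ** matrix_inv M" "N ** (M ** matrix_inv M) = N"
    using assms by simp_all
  then show ?thesis
    by (simp only: matrix_mul_assoc)
qed

lemma bounded_linear_smult_mat: "bounded_linear (\<lambda>c. c *\<^sub>m M)"
  by (intro linear_linear[THEN iffD2] linearI)
     (simp_all add: matrix2_eq_iff algebra_simps)

section \<open>Wirtinger derivatives\<close>

text \<open>The derivatives \<open>a\<close>, \<open>b\<close> are those with respect to the formally independent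
  variables \<open>z\<close> and \<open>cnj z\<close>.\<close>

definition has_wirtinger_deriv ::
  "(complex \<Rightarrow> complex) \<Rightarrow> complex \<Rightarrow> complex \<Rightarrow> complex \<Rightarrow> bool" where
  "has_wirtinger_deriv f a b z \<longleftrightarrow> (f has_derivative (\<lambda>h. h * a + cnj h * b)) (at z)"

definition has_matrix_wirtinger_deriv ::
  "(complex \<Rightarrow> complex^2^2) \<Rightarrow> complex^2^2 \<Rightarrow> complex^2^2 \<Rightarrow> complex \<Rightarrow> bool" where
  "has_matrix_wirtinger_deriv F M N z \<longleftrightarrow>
     (F has_derivative (\<lambda>h. h *\<^sub>m M + cnj h *\<^sub>m N)) (at z)"

lemma wirtinger_const: "has_wirtinger_deriv (\<lambda>_. c) 0 0 z"
  by (simp add: has_wirtinger_deriv_def)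

lemma wirtinger_cnj:
  assumes "has_wirtinger_deriv f a b z"
  shows "has_wirtinger_deriv (\<lambda>z. cnj (f z)) (cnj b) (cnj a) z"
  using has_derivative_cnj[OF assms[unfolded has_wirtinger_deriv_def]]
  by (simp add: has_wirtinger_deriv_def add.commute)

lemma wirtinger_add:
  assumes "has_wirtinger_deriv f a b z" "has_wirtinger_deriv g c d z"
  shows "has_wirtinger_deriv (\<lambda>z. f z + g z) (a + c) (b + d) z"
  using has_derivative_add[OF assms[unfolded has_wirtinger_deriv_def]]
  by (simp add: has_wirtinger_deriv_def algebra_simps)

lemma wirtinger_mult:
  assumes "has_wirtinger_deriv f a b z" "has_wirtinger_deriv g c d z"
  shows "has_wirtinger_deriv (\<lambda>z. f z * g z) (a * g z + f z * c) (b * g z + f z * d) z"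
  using has_derivative_mult[OF assms[unfolded has_wirtinger_deriv_def]]
  by (simp add: has_wirtinger_deriv_def algebra_simps)

lemma wirtinger_divide:
  assumes "has_wirtinger_deriv f a b z" "has_wirtinger_deriv g c d z" "g z \<noteq> 0"
  shows "has_wirtinger_deriv (\<lambda>z. f z / g z)
    ((a * g z - f z * c) / (g z)\<^sup>2) ((b * g z - f z * d) / (g z)\<^sup>2) z"
proof -
  have "((h * a + cnj h * b) * g z - f z * (h * c + cnj h * d)) / (g z * g z)
      = h * ((a * g z - f z * c) / (g z)\<^sup>2) + cnj h * ((b * g z - f z * d) / (g z)\<^sup>2)" for h
    using assms(3) by (simp add: power2_eq_square divide_simps) (simp add: algebra_simps)
  then show ?thesis
    using has_derivative_divide'[OF assms(1,2)[unfolded has_wirtinger_deriv_def] assms(3)]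
    by (simp add: has_wirtinger_deriv_def)
qed

lemma wirtinger_exp:
  assumes "has_wirtinger_deriv f a b z"
  shows "has_wirtinger_deriv (\<lambda>z. exp (f z)) (a * exp (f z)) (b * exp (f z)) z"
  using has_derivative_compose[OF assms[unfolded has_wirtinger_deriv_def]
      DERIV_exp[unfolded has_field_derivative_def]]
  by (simp add: has_wirtinger_deriv_def algebra_simps)

lemma wirtinger_id: "has_wirtinger_deriv (\<lambda>z. z) 1 0 z"
  by (simp add: has_wirtinger_deriv_def)

lemma wirtinger_cong:
  assumes "has_wirtinger_deriv f a b z" "a = a'" "b = b'"
  shows "has_wirtinger_deriv f a' b' z"
  using assms by simp

text \<open>Each entry is carried into the matrix by a bounded linear map
  \<open>c \<mapsto> c *\<^sub>m E\<close> with \<open>E\<close> a matrix unit, so the scalar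
  derivatives can be assembled term by term.\<close>

lemma wirtinger_mat2:
  assumes "has_wirtinger_deriv f1 a1 b1 z" "has_wirtinger_deriv f2 a2 b2 z"
    and "has_wirtinger_deriv f3 a3 b3 z" "has_wirtinger_deriv f4 a4 b4 z"
  shows "has_matrix_wirtinger_deriv (\<lambda>z. mat2 (f1 z) (f2 z) (f3 z) (f4 z))
    (mat2 a1 a2 a3 a4) (mat2 b1 b2 b3 b4) z"
proof -
  have split: "mat2 p q r s = p *\<^sub>m mat2 1 0 0 0 + q *\<^sub>m mat2 0 1 0 0 + r *\<^sub>m mat2 0 0 1 0
      + s *\<^sub>m mat2 0 0 0 1" for p q r s
    by (simp add: matrix2_eq_iff)
  note bounded_linear.has_derivative[OF bounded_linear_smult_mat]
  note D = this[OF assms(1)[unfolded has_wirtinger_deriv_def]]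
    this[OF assms(2)[unfolded has_wirtinger_deriv_def]]
    this[OF assms(3)[unfolded has_wirtinger_deriv_def]]
    this[OF assms(4)[unfolded has_wirtinger_deriv_def]]
  have "((\<lambda>z. mat2 (f1 z) (f2 z) (f3 z) (f4 z)) has_derivative
     (\<lambda>h. mat2 (h * a1 + cnj h * b1) (h * a2 + cnj h * b2) (h * a3 + cnj h * b3)
        (h * a4 + cnj h * b4))) (at z)"
    \<comment> \<open>Fixing the shape of the first entry keeps the rewriting away from the matrix
      units on the right of \<open>split\<close>, where it would loop.\<close>
    unfolding split[of "f1 _"] split[of "_ + _"]
    by (intro has_derivative_add D)
  moreover have "mat2 (h * a1 + cnj h * b1) (h * a2 + cnj h * b2) (h * a3 + cnj h * b3)
        (h * a4 + cnj h * b4) = h *\<^sub>m mat2 a1 a2 a3 a4 + cnj h *\<^sub>m mat2 b1 b2 b3 b4" for h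
    by (simp add: matrix2_eq_iff)
  ultimately show ?thesis
    by (simp add: has_matrix_wirtinger_deriv_def)
qed

lemma linear_form_has_derivative:
  "((\<lambda>x. \<Sum>i\<in>UNIV. (k::complex^4) $ i * complex_of_real ((x::real^4) $ i)) has_derivative
    (\<lambda>h. \<Sum>i\<in>UNIV. k $ i * complex_of_real (h $ i))) (at x)"
proof -
  have "bounded_linear (\<lambda>x::real^4. \<Sum>i\<in>UNIV. k $ i * complex_of_real (x $ i))"
    by (intro bounded_linear_sum bounded_linear_const_mult bounded_linear_of_real
        [THEN bounded_linear_compose] bounded_linear_vec_nth)
  then show ?thesis by (rule bounded_linear_imp_has_derivative)
qed

text \<open>Chain rule for functions of \<open>x\<close> that depend on \<open>L\<close> and
  \<open>cnj L\<close> only. As \<open>L\<close> is linear with gradient \<open>k\<close>, the two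
  Wirtinger derivatives enter with the constant weights \<open>k $ \<mu>\<close> and
  \<open>cnj (k $ \<mu>)\<close>.\<close>

lemma linear_phase_deriv:
  fixes k :: "complex^4"
  assumes L: "\<And>x. L x = (\<Sum>i\<in>UNIV. k $ i * complex_of_real (x $ i))"
    and F: "has_matrix_wirtinger_deriv F M N (L x)"
  shows "(\<lambda>x. F (L x)) differentiable (at x)"
    and "partial_deriv \<mu> (\<lambda>x. F (L x)) x = k $ \<mu> *\<^sub>m M + cnj (k $ \<mu>) *\<^sub>m N"
proof -
  let ?L' = "\<lambda>h. \<Sum>i\<in>UNIV. k $ i * complex_of_real (h $ i)"
  let ?D = "\<lambda>h. ?L' h *\<^sub>m M + cnj (?L' h) *\<^sub>m N"
  have "(L has_derivative ?L') (at x)"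
    using linear_form_has_derivative[of k x] unfolding L[abs_def] .
  then have D: "((\<lambda>x. F (L x)) has_derivative ?D) (at x)"
    using has_derivative_compose F unfolding has_matrix_wirtinger_deriv_def by blast
  then show "(\<lambda>x. F (L x)) differentiable (at x)"
    by (auto simp: differentiable_def)
  have ax: "?L' (t *\<^sub>R axis \<mu> 1) = complex_of_real t * k $ \<mu>" for t
    by (simp add: axis_def if_distrib if_distribR sum.delta' cong: if_cong)
  have "((\<lambda>t. x + t *\<^sub>R axis \<mu> (1::real)) has_derivative (\<lambda>t. t *\<^sub>R axis \<mu> 1)) (at 0)"
    by (auto intro!: derivative_eq_intros)
  from has_derivative_compose[OF this, of "\<lambda>x. F (L x)" ?D] D
  have "((\<lambda>t. F (L (x + t *\<^sub>R axis \<mu> 1))) has_derivative (\<lambda>t. ?D (t *\<^sub>R axis \<mu> 1))) (at 0)"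
    by simp
  moreover have "?D (t *\<^sub>R axis \<mu> 1) = t *\<^sub>R (k $ \<mu> *\<^sub>m M + cnj (k $ \<mu>) *\<^sub>m N)" for t
    unfolding ax by (simp add: matrix2_eq_iff) (simp add: scaleR_conv_of_real algebra_simps)
  ultimately have "((\<lambda>t. F (L (x + t *\<^sub>R axis \<mu> 1))) has_vector_derivative
      (k $ \<mu> *\<^sub>m M + cnj (k $ \<mu>) *\<^sub>m N)) (at 0)"
    by (simp only: has_vector_derivative_def)
  then show "partial_deriv \<mu> (\<lambda>x. F (L x)) x = k $ \<mu> *\<^sub>m M + cnj (k $ \<mu>) *\<^sub>m N"
    unfolding partial_deriv_def by (rule vector_derivative_at)
qed

lemma commutator_of_combinations:
  fixes R S :: "complex^2^2"
  shows "(c *\<^sub>m R + d *\<^sub>m S) ** (c' *\<^sub>m R + d' *\<^sub>m S) - (c' *\<^sub>m R + d' *\<^sub>m S) ** (c *\<^sub>m R + d *\<^sub>m S)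
    = (c * d' - d * c') *\<^sub>m (R ** S - S ** R)"
  by (simp add: matrix2_eq_iff matrix2_mult_nth algebra_simps)

text \<open>The entries of \<open>R\<close> and \<open>S\<close> have denominator
  \<open>D\<^sup>2\<close>. Dividing by \<open>g\<close> twice and cancelling one factor leaves a
  cubic denominator, where the quotient rule for \<open>g\<^sup>2\<close> would give a fourth
  power.\<close>

lemma wirtinger_divide_square:
  assumes "has_wirtinger_deriv f a b z" "has_wirtinger_deriv g c d z" "g z \<noteq> 0"
  shows "has_wirtinger_deriv (\<lambda>z. f z / (g z)\<^sup>2)
    ((a * g z - 2 * f z * c) / (g z) ^ 3) ((b * g z - 2 * f z * d) / (g z) ^ 3) z"
proof -
  have eq: "((u * y - x * e) / y\<^sup>2 * y - x / y * e) / y\<^sup>2 = (u * y - 2 * x * e) / y ^ 3"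
    if "y \<noteq> 0" for u x y e :: complex
    using that by (simp add: divide_simps) algebra
  from wirtinger_divide[OF wirtinger_divide[OF assms] assms(2,3)] show ?thesis
    by (simp only: eq[OF assms(3)] divide_divide_eq_left power2_eq_square[symmetric])
qed

text \<open>Serves both \<open>J\<close>, an affine function of the projection \<open>P\<close>, and
  the gauge fields, combinations of \<open>R\<close> and \<open>S\<close> with constant
  coefficients.\<close>

lemma matrix_wirtinger_affine:
  assumes "has_matrix_wirtinger_deriv F M N z" "has_matrix_wirtinger_deriv G M' N' z"
  shows "has_matrix_wirtinger_deriv (\<lambda>z. C + c *\<^sub>m F z + d *\<^sub>m G z)
    (c *\<^sub>m M + d *\<^sub>m M') (c *\<^sub>m N + d *\<^sub>m N') z"
proof -
  have "bounded_linear (\<lambda>X. e *\<^sub>m X)" for e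
    by (intro linear_linear[THEN iffD2] linearI)
       (simp_all add: matrix2_eq_iff algebra_simps)
  note S = bounded_linear.has_derivative[OF this]
  have "((\<lambda>z. C + c *\<^sub>m F z + d *\<^sub>m G z) has_derivative (\<lambda>h. 0 +
      c *\<^sub>m (h *\<^sub>m M + cnj h *\<^sub>m N) + d *\<^sub>m (h *\<^sub>m M' + cnj h *\<^sub>m N'))) (at z)"
    using assms unfolding has_matrix_wirtinger_deriv_def
    by (intro has_derivative_add has_derivative_const S)
  moreover have "0 + c *\<^sub>m (h *\<^sub>m M + cnj h *\<^sub>m N) + d *\<^sub>m (h *\<^sub>m M' + cnj h *\<^sub>m N') =
      h *\<^sub>m (c *\<^sub>m M + d *\<^sub>m M') + cnj h *\<^sub>m (c *\<^sub>m N + d *\<^sub>m N')" for h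
    by (simp add: matrix2_eq_iff algebra_simps)
  ultimately show ?thesis
    by (simp add: has_matrix_wirtinger_deriv_def)
qed

lemma smult_mat2: "c *\<^sub>m mat2 x1 x2 x3 x4 = mat2 (c * x1) (c * x2) (c * x3) (c * x4)"
  by (simp add: matrix2_eq_iff)

definition adjoint_mat :: "complex^2^2 \<Rightarrow> complex^2^2" where
  "adjoint_mat M = (\<chi> i j. cnj (M $ j $ i))"

text \<open>Conjugation exchanges \<open>h\<close> and \<open>cnj h\<close>, hence the two
  derivatives. The derivatives of \<open>S\<close> follow in this way from those of
  \<open>R\<close>.\<close>

lemma wirtinger_adjoint_mat:
  assumes "has_matrix_wirtinger_deriv F M N z"
  shows "has_matrix_wirtinger_deriv (\<lambda>z. adjoint_mat (F z)) (adjoint_mat N) (adjoint_mat M) z"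
proof -
  have "bounded_linear adjoint_mat"
    by (intro linear_linear[THEN iffD2] linearI)
       (simp_all add: matrix2_eq_iff adjoint_mat_def)
  from bounded_linear.has_derivative[OF this assms[unfolded has_matrix_wirtinger_deriv_def]]
  have "((\<lambda>z. adjoint_mat (F z)) has_derivative (\<lambda>h. adjoint_mat (h *\<^sub>m M + cnj h *\<^sub>m N))) (at z)" .
  moreover have "adjoint_mat (h *\<^sub>m M + cnj h *\<^sub>m N) = h *\<^sub>m adjoint_mat N + cnj h *\<^sub>m adjoint_mat M" for h
    by (simp add: matrix2_eq_iff adjoint_mat_def)
  ultimately show ?thesis
    by (simp add: has_matrix_wirtinger_deriv_def)
qed

section \<open>Constant vectors and two-forms on complex four-space\<close>

text \<open>Bilinear, without conjugation: this is the complexified Euclidean metric, so nonzero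
  vectors can be null.\<close>

definition dot :: "complex^4 \<Rightarrow> complex^4 \<Rightarrow> complex" where
  "dot u v = (\<Sum>\<mu>\<in>UNIV. u $ \<mu> * v $ \<mu>)"

definition wedge :: "complex^4 \<Rightarrow> complex^4 \<Rightarrow> 4 \<Rightarrow> 4 \<Rightarrow> complex" where
  "wedge u v \<mu> \<nu> = u $ \<mu> * v $ \<nu> - u $ \<nu> * v $ \<mu>"

text \<open>Evaluates a simple two-form on a pair of vectors; with frame vectors for
  \<open>x\<close> and \<open>y\<close> it yields the components in the coordinates z, z~, w,
  w~.\<close>

lemma sum_tensor_wedge:
  "(\<Sum>\<mu>\<in>UNIV. \<Sum>\<nu>\<in>UNIV. x $ \<mu> * y $ \<nu> * wedge u v \<mu> \<nu>) = dot x u * dot y v - dot y u * dot x v"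
proof -
  have "dot x u * dot y v = (\<Sum>\<mu>\<in>UNIV. \<Sum>\<nu>\<in>UNIV. x $ \<mu> * y $ \<nu> * (u $ \<mu> * v $ \<nu>))"
    unfolding dot_def sum_product by (intro sum.cong refl) (simp add: algebra_simps)
  moreover have "dot x v * dot y u = (\<Sum>\<mu>\<in>UNIV. \<Sum>\<nu>\<in>UNIV. x $ \<mu> * y $ \<nu> * (u $ \<nu> * v $ \<mu>))"
    unfolding dot_def sum_product by (intro sum.cong refl) (simp add: algebra_simps)
  ultimately show ?thesis
    by (simp add: wedge_def right_diff_distrib sum_subtractf mult.commute[of "dot y u"])
qed

text \<open>A Gram determinant, doubled because both orders of the index pair are summed.\<close>

lemma sum_wedge_wedge:
  "(\<Sum>\<mu>\<in>UNIV. \<Sum>\<nu>\<in>UNIV. wedge x y \<mu> \<nu> * wedge u v \<mu> \<nu>) = 2 * (dot x u * dot y v - dot y u * dot x v)"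
proof -
  have "wedge x y \<mu> \<nu> * wedge u v \<mu> \<nu> =
      x $ \<mu> * y $ \<nu> * wedge u v \<mu> \<nu> - y $ \<mu> * x $ \<nu> * wedge u v \<mu> \<nu>" for \<mu> \<nu>
    by (simp add: wedge_def algebra_simps)
  then show ?thesis
    by (simp add: sum_subtractf sum_tensor_wedge)
qed

lemma dot_commute: "dot u v = dot v u"
  by (simp add: dot_def mult.commute)

text \<open>The gradient of \<open>L\<close>.\<close>

definition phase_vec :: "complex \<Rightarrow> complex \<Rightarrow> complex \<Rightarrow> complex^4" where
  "phase_vec lam \<alpha> \<beta> = (1 / complex_of_real (sqrt 2)) *s
     vector [lam * \<alpha> + \<beta>, \<i> * (lam * \<alpha> - \<beta>), lam * \<beta> - \<alpha>, \<i> * (lam * \<beta> + \<alpha>)]"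

definition cnj_vec :: "complex^4 \<Rightarrow> complex^4" where
  "cnj_vec k = (\<chi> \<mu>. cnj (k $ \<mu>))"

text \<open>The coefficients of \<open>R\<close> and \<open>S\<close> in \<open>A\<^sub>\<mu>\<close>, with \<open>R\<close> and \<open>S\<close> as defined in the locale below.\<close>

definition R_coeff :: "complex \<Rightarrow> complex \<Rightarrow> complex \<Rightarrow> complex^4" where
  "R_coeff lam \<alpha> \<beta> = (- (1 / complex_of_real (sqrt 2)) * (lam * cnj lam + 1) / cnj lam) *s
     vector [\<alpha>, \<i> * \<alpha>, \<beta>, \<i> * \<beta>]"

definition S_coeff :: "complex \<Rightarrow> complex \<Rightarrow> complex \<Rightarrow> complex^4" where
  "S_coeff lam \<alpha> \<beta> = (1 / complex_of_real (sqrt 2) * (lam * cnj lam + 1)) *s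
     vector [cnj \<beta>, \<i> * cnj \<beta>, - cnj \<alpha>, - \<i> * cnj \<alpha>]"

text \<open>Up to sign, the value of the two nonzero products of a gradient with a coefficient
  vector; its square becomes the prefactor of the density.\<close>

definition K_coeff :: "complex \<Rightarrow> complex \<Rightarrow> complex \<Rightarrow> complex" where
  "K_coeff lam \<alpha> \<beta> = (\<alpha> * cnj \<alpha> + \<beta> * cnj \<beta>) * (lam * cnj lam + 1)"

lemma dot_scale: "dot (x *s u) (y *s v) = x * y * dot u v"
  by (simp add: dot_def sum_distrib_left algebra_simps)

lemma dot_vector:
  "dot (vector [x1, x2, x3, x4]) (vector [y1, y2, y3, y4]) = x1 * y1 + x2 * y2 + x3 * y3 + x4 * y4"
  by (simp add: dot_def sum_4 vector4_nth)

lemma cnj_phase_vec: "cnj_vec (phase_vec lam \<alpha> \<beta>) = (1 / complex_of_real (sqrt 2)) *s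
     vector [cnj lam * cnj \<alpha> + cnj \<beta>, - \<i> * (cnj lam * cnj \<alpha> - cnj \<beta>), cnj lam * cnj \<beta> - cnj \<alpha>,
       - \<i> * (cnj lam * cnj \<beta> + cnj \<alpha>)]"
  by (simp add: cnj_vec_def phase_vec_def vec_eq_iff forall_4 vector4_nth)

lemma sqrt2_sqrt2: "complex_of_real (sqrt 2) * complex_of_real (sqrt 2) = 2"
  "complex_of_real (sqrt 2) * (complex_of_real (sqrt 2) * x) = 2 * x"
  by (simp_all flip: of_real_mult mult.assoc)

text \<open>\<open>R_coeff\<close> and \<open>S_coeff\<close> both have the form
  \<open>(s, \<i> s, t, \<i> t)\<close>, so their products cancel in pairs: they lie in one totally
  null plane. Each is also orthogonal to one of the gradients of \<open>L\<close> and
  \<open>cnj L\<close>.\<close>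

lemma dots_phase:
  assumes "lam \<noteq> 0"
  shows "dot (phase_vec lam \<alpha> \<beta>) (R_coeff lam \<alpha> \<beta>) = 0"
    and "dot (cnj_vec (phase_vec lam \<alpha> \<beta>)) (S_coeff lam \<alpha> \<beta>) = 0"
    and "dot (phase_vec lam \<alpha> \<beta>) (S_coeff lam \<alpha> \<beta>) = K_coeff lam \<alpha> \<beta>"
    and "dot (cnj_vec (phase_vec lam \<alpha> \<beta>)) (R_coeff lam \<alpha> \<beta>) = - K_coeff lam \<alpha> \<beta>"
    and "dot (R_coeff lam \<alpha> \<beta>) (R_coeff lam \<alpha> \<beta>) = 0"
    and "dot (R_coeff lam \<alpha> \<beta>) (S_coeff lam \<alpha> \<beta>) = 0"
    and "dot (S_coeff lam \<alpha> \<beta>) (S_coeff lam \<alpha> \<beta>) = 0"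
  using assms
  unfolding cnj_phase_vec unfolding K_coeff_def phase_vec_def R_coeff_def S_coeff_def dot_scale dot_vector
  by (simp_all add: field_simps sqrt2_sqrt2)

text \<open>The values for \<open>phase_vec\<close> are the coefficients in \<open>L = lam \<alpha>
  z + \<beta> z~ + lam \<beta> w + \<alpha> w~\<close>. The zeros for \<open>R_coeff\<close> and
  \<open>S_coeff\<close> say that the potential has no components along z~ and w~.\<close>

lemma dots_frame:
  assumes "lam \<noteq> 0"
  shows "dot frame_z (phase_vec lam \<alpha> \<beta>) = lam * \<alpha>"
    "dot frame_zt (phase_vec lam \<alpha> \<beta>) = \<beta>"
    "dot frame_w (phase_vec lam \<alpha> \<beta>) = lam * \<beta>"
    "dot frame_wt (phase_vec lam \<alpha> \<beta>) = \<alpha>"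
    "dot frame_z (cnj_vec (phase_vec lam \<alpha> \<beta>)) = cnj \<beta>"
    "dot frame_zt (cnj_vec (phase_vec lam \<alpha> \<beta>)) = cnj lam * cnj \<alpha>"
    "dot frame_w (cnj_vec (phase_vec lam \<alpha> \<beta>)) = - cnj \<alpha>"
    "dot frame_wt (cnj_vec (phase_vec lam \<alpha> \<beta>)) = - cnj lam * cnj \<beta>"
    "dot frame_z (R_coeff lam \<alpha> \<beta>) = - (lam * cnj lam + 1) / cnj lam * \<alpha>"
    "dot frame_zt (R_coeff lam \<alpha> \<beta>) = 0"
    "dot frame_w (R_coeff lam \<alpha> \<beta>) = - (lam * cnj lam + 1) / cnj lam * \<beta>"
    "dot frame_wt (R_coeff lam \<alpha> \<beta>) = 0"
    "dot frame_z (S_coeff lam \<alpha> \<beta>) = (lam * cnj lam + 1) * cnj \<beta>"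
    "dot frame_zt (S_coeff lam \<alpha> \<beta>) = 0"
    "dot frame_w (S_coeff lam \<alpha> \<beta>) = - (lam * cnj lam + 1) * cnj \<alpha>"
    "dot frame_wt (S_coeff lam \<alpha> \<beta>) = 0"
  using assms
  unfolding cnj_phase_vec unfolding phase_vec_def R_coeff_def S_coeff_def frame_z_def frame_zt_def
    frame_w_def frame_wt_def dot_scale dot_vector
  by (simp_all add: field_simps sqrt2_sqrt2)

section \<open>The projection attached to a pair of exponential sums\<close>

locale exponential_pair =
  fixes a1 a2 b1 b2 :: complex
  assumes det_nonzero: "a1 * b2 - a2 * b1 \<noteq> 0"
begin

definition p :: "complex \<Rightarrow> complex" where "p z = a1 * exp z + a2 * exp (- z)"
definition p' :: "complex \<Rightarrow> complex" where "p' z = a1 * exp z - a2 * exp (- z)"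
definition q :: "complex \<Rightarrow> complex" where "q z = b1 * exp z + b2 * exp (- z)"
definition q' :: "complex \<Rightarrow> complex" where "q' z = b1 * exp z - b2 * exp (- z)"

text \<open>\<open>D\<close> is the determinant of \<open>psi\<close>, and \<open>DL\<close> will be
  its derivative in \<open>z\<close>.\<close>

definition D :: "complex \<Rightarrow> complex" where "D z = p z * cnj (p z) + q z * cnj (q z)"
definition DL :: "complex \<Rightarrow> complex" where "DL z = p' z * cnj (p z) + q' z * cnj (q z)"

definition w :: complex where "w = a1 * b2 - a2 * b1"

text \<open>\<open>P\<close> is the orthogonal projection onto the line spanned by \<open>(p, - q)\<close>. Its Wirtinger
  derivatives are \<open>R\<close> and \<open>S\<close>, and \<open>Q\<close> is its mixed second derivative.\<close>

definition P :: "complex \<Rightarrow> complex^2^2" where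
  "P z = mat2 (p z * cnj (p z) / D z) (- (p z * cnj (q z)) / D z)
              (- (q z * cnj (p z)) / D z) (q z * cnj (q z) / D z)"

definition R :: "complex \<Rightarrow> complex^2^2" where
  "R z = mat2 (2 * w * (cnj (p z) * cnj (q z)) / (D z)\<^sup>2) (- 2 * w * (cnj (q z) * cnj (q z)) / (D z)\<^sup>2)
              (2 * w * (cnj (p z) * cnj (p z)) / (D z)\<^sup>2) (- 2 * w * (cnj (p z) * cnj (q z)) / (D z)\<^sup>2)"

definition S :: "complex \<Rightarrow> complex^2^2" where
  "S z = mat2 (2 * cnj w * (p z * q z) / (D z)\<^sup>2) (2 * cnj w * (p z * p z) / (D z)\<^sup>2)
              (- 2 * cnj w * (q z * q z) / (D z)\<^sup>2) (- 2 * cnj w * (p z * q z) / (D z)\<^sup>2)"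

definition Q :: "complex \<Rightarrow> complex^2^2" where
  "Q z = (4 * w * cnj w / D z ^ 3) *\<^sub>m
     mat2 (q z * cnj (q z) - p z * cnj (p z)) (2 * p z * cnj (q z))
          (2 * q z * cnj (p z)) (p z * cnj (p z) - q z * cnj (q z))"

lemma exp_cancel: "exp z * exp (- z) = (1 :: complex)"
  by (simp flip: exp_add)

text \<open>The squares of the exponentials cancel and the mixed terms are constant. This identity
  brings the derivatives of \<open>P\<close> into closed form and excludes common zeros of
  \<open>p\<close> and \<open>q\<close>.\<close>

lemma wronskian: "2 * w = p' z * q z - p z * q' z"
  unfolding w_def p_def p'_def q_def q'_def using exp_cancel[of z] by algebra

lemma wronskian_cnj: "2 * cnj w = cnj (p' z) * cnj (q z) - cnj (p z) * cnj (q' z)"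
  using arg_cong[OF wronskian[of z], of cnj] by simp

lemma w_nonzero: "w \<noteq> 0"
  using det_nonzero by (simp add: w_def)

lemma D_eq_norm: "D z = complex_of_real ((cmod (p z))\<^sup>2 + (cmod (q z))\<^sup>2)"
  by (simp add: D_def complex_norm_square del: of_real_power)

lemma D_nonzero: "D z \<noteq> 0"
proof
  assume "D z = 0"
  then have "(cmod (p z))\<^sup>2 + (cmod (q z))\<^sup>2 = 0"
    unfolding D_eq_norm of_real_eq_0_iff .
  then have "p z = 0" "q z = 0"
    by (auto simp: sum_power2_eq_zero_iff)
  then show False
    using wronskian[of z] w_nonzero by simp
qed

lemma cnj_D: "cnj (D z) = D z"
  by (simp add: D_def algebra_simps)

lemma wirtinger_p: "has_wirtinger_deriv p (p' z) 0 z"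
proof -
  have "has_wirtinger_deriv (\<lambda>z. a1 * exp z + a2 * exp (- 1 * z)) (p' z) 0 z"
    by (rule wirtinger_cong[OF wirtinger_add[OF
          wirtinger_mult[OF wirtinger_const wirtinger_exp[OF wirtinger_id]]
          wirtinger_mult[OF wirtinger_const
            wirtinger_exp[OF wirtinger_mult[OF wirtinger_const wirtinger_id]]]]])
       (simp_all add: p'_def)
  then show ?thesis by (simp add: p_def[abs_def])
qed

lemma wirtinger_q: "has_wirtinger_deriv q (q' z) 0 z"
proof -
  have "has_wirtinger_deriv (\<lambda>z. b1 * exp z + b2 * exp (- 1 * z)) (q' z) 0 z"
    by (rule wirtinger_cong[OF wirtinger_add[OF
          wirtinger_mult[OF wirtinger_const wirtinger_exp[OF wirtinger_id]]
          wirtinger_mult[OF wirtinger_const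
            wirtinger_exp[OF wirtinger_mult[OF wirtinger_const wirtinger_id]]]]])
       (simp_all add: q'_def)
  then show ?thesis by (simp add: q_def[abs_def])
qed

lemmas wirtinger_cnj_p = wirtinger_cnj[OF wirtinger_p, simplified]
lemmas wirtinger_cnj_q = wirtinger_cnj[OF wirtinger_q, simplified]

lemma wirtinger_D: "has_wirtinger_deriv D (DL z) (cnj (DL z)) z"
  unfolding D_def[abs_def]
  by (rule wirtinger_cong[OF wirtinger_add[OF wirtinger_mult[OF wirtinger_p wirtinger_cnj_p]
        wirtinger_mult[OF wirtinger_q wirtinger_cnj_q]]])
     (simp_all add: DL_def algebra_simps)

text \<open>In each numerator of the quotient rule all terms combine into a multiple of the
  Wronskian of \<open>p\<close> and \<open>q\<close>, or of its conjugate.\<close>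

lemma wirtinger_P: "has_matrix_wirtinger_deriv P (R z) (S z) z"
proof -
  note pp = wirtinger_mult[OF wirtinger_p wirtinger_cnj_p, of z]
    and pq = wirtinger_mult[OF wirtinger_const[of "-1"] wirtinger_mult[OF wirtinger_p wirtinger_cnj_q], of z]
    and qp = wirtinger_mult[OF wirtinger_const[of "-1"] wirtinger_mult[OF wirtinger_q wirtinger_cnj_p], of z]
    and qq = wirtinger_mult[OF wirtinger_q wirtinger_cnj_q, of z]
  note W = wronskian[of z] wronskian_cnj[of z]
    and expand = D_def DL_def complex_cnj_add complex_cnj_mult complex_cnj_cnj
  note div = wirtinger_cong[OF wirtinger_divide[OF _ wirtinger_D D_nonzero]]
  have "has_wirtinger_deriv (\<lambda>z. p z * cnj (p z) / D z)
      (2 * w * (cnj (p z) * cnj (q z)) / (D z)\<^sup>2) (2 * cnj w * (p z * q z) / (D z)\<^sup>2) z"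
    by (rule div[OF pp];
        rule arg_cong[where f = "\<lambda>t. t / _"]; unfold expand; insert W; algebra)
  moreover have "has_wirtinger_deriv (\<lambda>z. -1 * (p z * cnj (q z)) / D z)
      (- 2 * w * (cnj (q z) * cnj (q z)) / (D z)\<^sup>2) (2 * cnj w * (p z * p z) / (D z)\<^sup>2) z"
    by (rule div[OF pq];
        rule arg_cong[where f = "\<lambda>t. t / _"]; unfold expand; insert W; algebra)
  moreover have "has_wirtinger_deriv (\<lambda>z. -1 * (q z * cnj (p z)) / D z)
      (2 * w * (cnj (p z) * cnj (p z)) / (D z)\<^sup>2) (- 2 * cnj w * (q z * q z) / (D z)\<^sup>2) z"
    by (rule div[OF qp];
        rule arg_cong[where f = "\<lambda>t. t / _"]; unfold expand; insert W; algebra)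
  moreover have "has_wirtinger_deriv (\<lambda>z. q z * cnj (q z) / D z)
      (- 2 * w * (cnj (p z) * cnj (q z)) / (D z)\<^sup>2) (- 2 * cnj w * (p z * q z) / (D z)\<^sup>2) z"
    by (rule div[OF qq];
        rule arg_cong[where f = "\<lambda>t. t / _"]; unfold expand; insert W; algebra)
  ultimately show ?thesis
    using wirtinger_mat2 unfolding P_def[abs_def] R_def S_def by simp
qed

text \<open>The numerators of \<open>R\<close> are antiholomorphic, so \<open>z\<close> acts only
  through \<open>D\<^sup>2\<close> and gives a logarithmic derivative. In the other variable the
  conjugate Wronskian factors out once more.\<close>

lemma wirtinger_R: "has_matrix_wirtinger_deriv R ((- 2 * DL z / D z) *\<^sub>m R z) (Q z) z"
proof -
  note uv = wirtinger_mult[OF wirtinger_const wirtinger_mult[OF wirtinger_cnj_p wirtinger_cnj_q], of _ z]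
    and vv = wirtinger_mult[OF wirtinger_const wirtinger_mult[OF wirtinger_cnj_q wirtinger_cnj_q], of _ z]
    and uu = wirtinger_mult[OF wirtinger_const wirtinger_mult[OF wirtinger_cnj_p wirtinger_cnj_p], of _ z]
  note W = wronskian[of z] wronskian_cnj[of z]
    and expand = D_def DL_def complex_cnj_add complex_cnj_mult complex_cnj_cnj
  note div = wirtinger_cong[OF wirtinger_divide_square[OF _ wirtinger_D D_nonzero]]
  \<comment> \<open>The left side is the unsimplified output of the product and quotient rules; its
    zeros are the \<open>z\<close>-derivatives of the constant and of the conjugated
    factors.\<close>
  have log_deriv: "((0 * x + k * (0 * y + x' * 0)) * D z - 2 * (k * f) * DL z) / D z ^ 3 
    = (- 2 * DL z / D z) * (k * f / (D z)\<^sup>2)" for k f x y x'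
    using D_nonzero[of z] by (simp add: divide_simps power2_eq_square power3_eq_cube)
  have scale: "x / D z ^ 3 = 4 * w * cnj w / D z ^ 3 * y" if "x = 4 * w * cnj w * y" for x y
    using that by simp
  have "has_wirtinger_deriv (\<lambda>z. 2 * w * (cnj (p z) * cnj (q z)) / (D z)\<^sup>2)
      ((- 2 * DL z / D z) * (2 * w * (cnj (p z) * cnj (q z)) / (D z)\<^sup>2))
      (4 * w * cnj w / D z ^ 3 * (q z * cnj (q z) - p z * cnj (p z))) z"
    by (rule div[OF uv];
        (rule log_deriv)?; (rule scale)?; unfold expand; insert W; algebra)
  moreover have "has_wirtinger_deriv (\<lambda>z. - 2 * w * (cnj (q z) * cnj (q z)) / (D z)\<^sup>2)
      ((- 2 * DL z / D z) * (- 2 * w * (cnj (q z) * cnj (q z)) / (D z)\<^sup>2))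
      (4 * w * cnj w / D z ^ 3 * (2 * p z * cnj (q z))) z"
    by (rule div[OF vv];
        (rule log_deriv)?; (rule scale)?; unfold expand; insert W; algebra)
  moreover have "has_wirtinger_deriv (\<lambda>z. 2 * w * (cnj (p z) * cnj (p z)) / (D z)\<^sup>2)
      ((- 2 * DL z / D z) * (2 * w * (cnj (p z) * cnj (p z)) / (D z)\<^sup>2))
      (4 * w * cnj w / D z ^ 3 * (2 * q z * cnj (p z))) z"
    by (rule div[OF uu];
        (rule log_deriv)?; (rule scale)?; unfold expand; insert W; algebra)
  moreover have "has_wirtinger_deriv (\<lambda>z. - 2 * w * (cnj (p z) * cnj (q z)) / (D z)\<^sup>2)
      ((- 2 * DL z / D z) * (- 2 * w * (cnj (p z) * cnj (q z)) / (D z)\<^sup>2))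
      (4 * w * cnj w / D z ^ 3 * (p z * cnj (p z) - q z * cnj (q z))) z"
    by (rule div[OF uv];
        (rule log_deriv)?; (rule scale)?; unfold expand; insert W; algebra)
  ultimately have "has_matrix_wirtinger_deriv R
      (mat2 ((- 2 * DL z / D z) * (2 * w * (cnj (p z) * cnj (q z)) / (D z)\<^sup>2))
        ((- 2 * DL z / D z) * (- 2 * w * (cnj (q z) * cnj (q z)) / (D z)\<^sup>2))
        ((- 2 * DL z / D z) * (2 * w * (cnj (p z) * cnj (p z)) / (D z)\<^sup>2))
        ((- 2 * DL z / D z) * (- 2 * w * (cnj (p z) * cnj (q z)) / (D z)\<^sup>2)))
      (mat2 (4 * w * cnj w / D z ^ 3 * (q z * cnj (q z) - p z * cnj (p z)))
        (4 * w * cnj w / D z ^ 3 * (2 * p z * cnj (q z)))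
        (4 * w * cnj w / D z ^ 3 * (2 * q z * cnj (p z)))
        (4 * w * cnj w / D z ^ 3 * (p z * cnj (p z) - q z * cnj (q z)))) z"
    unfolding R_def[abs_def] by (rule wirtinger_mat2)
  then show ?thesis
    unfolding smult_mat2[symmetric] R_def[symmetric] Q_def[symmetric] .
qed

text \<open>Since \<open>D\<close> is real, \<open>S\<close> is the adjoint of \<open>R\<close> and
  \<open>Q\<close> is self-adjoint, so the adjoint of the previous lemma is the claim.\<close>

lemma wirtinger_S: "has_matrix_wirtinger_deriv S (Q z) ((- 2 * cnj (DL z) / D z) *\<^sub>m S z) z"
proof -
  have S: "S z = adjoint_mat (R z)" for z
    by (simp add: matrix2_eq_iff adjoint_mat_def R_def S_def cnj_D)
  have Q: "Q z = adjoint_mat (Q z)"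
    by (simp add: matrix2_eq_iff adjoint_mat_def Q_def cnj_D)
  have "adjoint_mat ((- 2 * DL z / D z) *\<^sub>m R z) = (- 2 * cnj (DL z) / D z) *\<^sub>m S z"
    unfolding S by (simp add: matrix2_eq_iff adjoint_mat_def cnj_D)
  then show ?thesis
    using wirtinger_adjoint_mat[OF wirtinger_R, of z] by (simp add: S[symmetric, abs_def] Q[symmetric])
qed

section \<open>Algebra of the projection and its derivatives\<close>

lemma P_idem: "P z ** P z = P z"
  using D_nonzero[of z] unfolding P_def
  by (simp add: matrix2_eq_iff matrix2_mult_nth divide_simps; unfold D_def; algebra)

text \<open>\<open>R\<close> is \<open>2 w / D\<^sup>2\<close> times the column
  \<open>(cnj q, cnj p)\<close> times the row \<open>(cnj p, - cnj q)\<close>, and \<open>P\<close>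
  fixes this row from the right.\<close>

lemma R_P: "R z ** P z = R z"
  using D_nonzero[of z] unfolding P_def R_def
  by (simp add: matrix2_eq_iff matrix2_mult_nth divide_simps power2_eq_square; unfold D_def; algebra)

text \<open>\<open>S\<close> is \<open>2 cnj w / D\<^sup>2\<close> times the column
  \<open>(p, - q)\<close> times the row \<open>(q, p)\<close>, and this row annihilates the range of
  \<open>P\<close>.\<close>

lemma S_P: "S z ** P z = 0"
  using D_nonzero[of z] unfolding P_def S_def
  by (simp add: matrix2_eq_iff matrix2_mult_nth divide_simps power2_eq_square; unfold D_def; algebra)

text \<open>By the outer product forms, \<open>R S\<close> and \<open>S R\<close> are
  \<open>4 w cnj w / D\<^sup>2\<close> times the complementary projections \<open>1 - P\<close> and
  \<open>P\<close>.\<close>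

lemma R_S_commutator: "R z ** S z - S z ** R z = Q z"
  using D_nonzero[of z] unfolding Q_def R_def S_def
  by (simp add: matrix2_eq_iff matrix2_mult_nth divide_simps power2_eq_square power3_eq_cube;
      unfold D_def; algebra)

lemma trace_R: "trace (R z) = 0" and trace_S: "trace (S z) = 0"
  by (simp_all add: trace_2 R_def S_def)

text \<open>\<open>R\<close> and \<open>S\<close> square to zero and are trace-orthogonal to
  \<open>Q\<close>, while the square of \<open>Q\<close> is scalar. Only the product
  \<open>x t\<close> and the square of \<open>y\<close> survive.\<close>

lemma trace_square_combination:
  fixes x y t :: complex
  assumes "F = x *\<^sub>m R z + y *\<^sub>m Q z + t *\<^sub>m S z"
  shows "trace (F ** F) = 8 * x * t * w * cnj w / (D z)\<^sup>2 + y\<^sup>2 * (32 * (w * cnj w)\<^sup>2 / D z ^ 4)"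
  using D_nonzero[of z] unfolding assms Q_def R_def S_def
  by (simp add: trace_2 matrix2_mult_nth divide_simps power2_eq_square power3_eq_cube power4_eq_xxxx;
      unfold D_def; algebra)

section \<open>The matrices psi and J and the current of J\<close>

definition psi :: "complex \<Rightarrow> complex^2^2" where
  "psi z = mat2 (p z) (cnj (q z)) (- q z) (cnj (p z))"

definition psi_inv :: "complex \<Rightarrow> complex^2^2" where
  "psi_inv z = (1 / D z) *\<^sub>m mat2 (cnj (p z)) (- cnj (q z)) (q z) (p z)"

lemma psi_inverse: "psi z ** psi_inv z = mat 1" "psi_inv z ** psi z = mat 1"
proof -
  show "psi z ** psi_inv z = mat 1"
    using D_nonzero[of z] unfolding psi_def psi_inv_def
    by (simp add: matrix2_eq_iff matrix2_mult_nth field_simps; simp add: D_def algebra_simps)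
  then show "psi_inv z ** psi z = mat 1"
    by (simp add: matrix_left_right_inverse)
qed

text \<open>The columns \<open>(p, - q)\<close> and \<open>(cnj q, cnj p)\<close> of
  \<open>psi\<close> are orthogonal, so conjugating by \<open>psi\<close> gives spectral projections
  \<open>P\<close> and \<open>1 - P\<close>. The eigenvalues here are \<open>- lam\<close> and
  \<open>1 / cnj lam\<close>; \<open>J_inv_of\<close> has the reciprocal ones.\<close>

definition J_of :: "complex \<Rightarrow> complex \<Rightarrow> complex^2^2" where
  "J_of lam z = mat (1 / cnj lam) - ((lam * cnj lam + 1) / cnj lam) *\<^sub>m P z"

definition J_inv_of :: "complex \<Rightarrow> complex \<Rightarrow> complex^2^2" where
  "J_inv_of lam z = mat (cnj lam) - ((lam * cnj lam + 1) / lam) *\<^sub>m P z"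

lemma J_of_eq_conjugation:
  assumes "lam \<noteq> 0"
  shows "- (psi z ** mat2 lam 0 0 (- 1 / cnj lam) ** psi_inv z) = J_of lam z"
  using assms D_nonzero[of z] unfolding psi_def psi_inv_def J_of_def P_def
  by (simp add: matrix2_eq_iff matrix2_mult_nth divide_simps; unfold D_def; algebra)

lemma J_of_inverse:
  assumes "lam \<noteq> 0"
  shows "J_of lam z ** J_inv_of lam z = mat 1" "J_inv_of lam z ** J_of lam z = mat 1"
proof -
  have "(mat a - b *\<^sub>m P z) ** (mat c - d *\<^sub>m P z) = mat 1"
    if "a * c = 1" "b * d = a * d + b * c" for a b c d :: complex
  proof -
    have "(mat a - b *\<^sub>m P z) ** (mat c - d *\<^sub>m P z) =
        mat (a * c) - (a * d + b * c) *\<^sub>m P z + (b * d) *\<^sub>m (P z ** P z)"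
      by (simp add: matrix2_eq_iff matrix2_mult_nth algebra_simps)
    also have "\<dots> = mat 1"
      using that unfolding P_idem by (simp add: matrix2_eq_iff)
    finally show ?thesis .
  qed
  note this[of "1 / cnj lam" "cnj lam" "(lam * cnj lam + 1) / cnj lam" "(lam * cnj lam + 1) / lam"]
    this[of "cnj lam" "1 / cnj lam" "(lam * cnj lam + 1) / lam" "(lam * cnj lam + 1) / cnj lam"]
  then show "J_of lam z ** J_inv_of lam z = mat 1" "J_inv_of lam z ** J_of lam z = mat 1"
    using assms unfolding J_of_def J_inv_of_def
    by (simp_all add: field_simps)
qed

lemma wirtinger_J:
  defines "k lam \<equiv> - ((lam * cnj lam + 1) / cnj lam)"
  shows "has_matrix_wirtinger_deriv (J_of lam) (k lam *\<^sub>m R z) (k lam *\<^sub>m S z) z"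
proof -
  \<comment> \<open>The second summand of the affine rule is filled with coefficient 0.\<close>
  have "J_of lam = (\<lambda>z. mat (1 / cnj lam) + k lam *\<^sub>m P z + 0 *\<^sub>m P z)"
    by (simp add: fun_eq_iff J_of_def k_def matrix2_eq_iff)
  moreover have "k lam *\<^sub>m M + 0 *\<^sub>m M = k lam *\<^sub>m M" for M
    by (simp add: matrix2_eq_iff)
  ultimately show ?thesis
    using matrix_wirtinger_affine[OF wirtinger_P wirtinger_P, where C = "mat (1 / cnj lam)"
        and c = "k lam" and d = 0] by simp
qed

text \<open>For \<open>u = k $ \<mu>\<close> and \<open>v = cnj (k $ \<mu>)\<close> the left side is
  the derivative of \<open>J\<close> times the inverse of \<open>J\<close>. By \<open>R_P\<close>
  and \<open>S_P\<close>, right multiplication by the inverse scales \<open>R\<close> by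
  \<open>- 1 / lam\<close> and \<open>S\<close> by \<open>cnj lam\<close>.\<close>

lemma current_eq:
  assumes "lam \<noteq> 0"
  defines "k \<equiv> - ((lam * cnj lam + 1) / cnj lam)"
  shows "(u *\<^sub>m k *\<^sub>m R z + v *\<^sub>m k *\<^sub>m S z) ** J_inv_of lam z =
    (u * (lam * cnj lam + 1) / (lam * cnj lam)) *\<^sub>m R z + (- v * (lam * cnj lam + 1)) *\<^sub>m S z"
proof -
  have "(u *\<^sub>m k *\<^sub>m R z + v *\<^sub>m k *\<^sub>m S z) ** (mat l - e *\<^sub>m P z) =
      (u * k * l) *\<^sub>m R z + (v * k * l) *\<^sub>m S z
      - (u * k * e) *\<^sub>m (R z ** P z) - (v * k * e) *\<^sub>m (S z ** P z)" for l e
    by (simp add: matrix2_eq_iff matrix2_mult_nth algebra_simps)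
  then have "(u *\<^sub>m k *\<^sub>m R z + v *\<^sub>m k *\<^sub>m S z) ** J_inv_of lam z =
      (u * k * cnj lam) *\<^sub>m R z + (v * k * cnj lam) *\<^sub>m S z
      - (u * k * ((lam * cnj lam + 1) / lam)) *\<^sub>m (R z ** P z)
      - (v * k * ((lam * cnj lam + 1) / lam)) *\<^sub>m (S z ** P z)"
    unfolding J_inv_of_def .
  also have "\<dots> = (u * k * cnj lam - u * k * ((lam * cnj lam + 1) / lam)) *\<^sub>m R z + (v * k * cnj lam) *\<^sub>m S z"
    unfolding R_P S_P by (simp add: matrix2_eq_iff algebra_simps)
  also have "u * k * cnj lam - u * k * ((lam * cnj lam + 1) / lam) = u * (lam * cnj lam + 1) / (lam * cnj lam)"
    using assms by (simp add: k_def field_simps)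
  also have "v * k * cnj lam = - v * (lam * cnj lam + 1)"
    using assms by (simp add: k_def)
  finally show ?thesis .
qed

section \<open>Field strength, its components and the density for constant coefficient
  vectors\<close>

lemma field_strength_eq:
  fixes A :: gauge_field and k c d :: "complex^4"
  assumes L: "\<And>x. L x = (\<Sum>i\<in>UNIV. k $ i * complex_of_real (x $ i))"
    and A: "\<And>\<mu>. A \<mu> = (\<lambda>x. c $ \<mu> *\<^sub>m R (L x) + d $ \<mu> *\<^sub>m S (L x))"
  shows "A \<mu> differentiable (at x)"
    and "field_strength A \<mu> \<nu> x =
      (wedge k c \<mu> \<nu> * (- 2 * DL (L x) / D (L x))) *\<^sub>m R (L x)
      + (wedge (cnj_vec k) c \<mu> \<nu> + wedge k d \<mu> \<nu> + wedge c d \<mu> \<nu>) *\<^sub>m Q (L x)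
      + (wedge (cnj_vec k) d \<mu> \<nu> * (- 2 * cnj (DL (L x)) / D (L x))) *\<^sub>m S (L x)"
proof -
  let ?z = "L x" and ?\<rho> = "- 2 * DL (L x) / D (L x)" and ?\<sigma> = "- 2 * cnj (DL (L x)) / D (L x)"
  have zero: "0 + M = M" for M :: "complex^2^2" by simp
  note W = matrix_wirtinger_affine[OF wirtinger_R wirtinger_S, of 0, unfolded zero]
  show "A \<mu> differentiable (at x)"
    unfolding A by (rule linear_phase_deriv(1)[OF L W])
  have D: "partial_deriv \<mu> (A \<nu>) x =
      k $ \<mu> *\<^sub>m (c $ \<nu> *\<^sub>m ?\<rho> *\<^sub>m R ?z + d $ \<nu> *\<^sub>m Q ?z)
      + cnj (k $ \<mu>) *\<^sub>m (c $ \<nu> *\<^sub>m Q ?z + d $ \<nu> *\<^sub>m ?\<sigma> *\<^sub>m S ?z)" for \<mu> \<nu>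
    unfolding A by (rule linear_phase_deriv(2)[OF L W])
  \<comment> \<open>The commutator produces the same matrix \<open>Q\<close> as the two mixed
    derivatives, so three two-forms add up in its coefficient.\<close>
  have "A \<mu> x ** A \<nu> x - A \<nu> x ** A \<mu> x = (c $ \<mu> * d $ \<nu> - d $ \<mu> * c $ \<nu>) *\<^sub>m Q ?z"
    unfolding A commutator_of_combinations R_S_commutator ..
  moreover have "(k1 *\<^sub>m (c2 *\<^sub>m r *\<^sub>m U + d2 *\<^sub>m V) + l1 *\<^sub>m (c2 *\<^sub>m V + d2 *\<^sub>m s *\<^sub>m W))
      - (k2 *\<^sub>m (c1 *\<^sub>m r *\<^sub>m U + d1 *\<^sub>m V) + l2 *\<^sub>m (c1 *\<^sub>m V + d1 *\<^sub>m s *\<^sub>m W))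
      + (c1 * d2 - d1 * c2) *\<^sub>m V =
      ((k1 * c2 - k2 * c1) * r) *\<^sub>m U
      + (l1 * c2 - l2 * c1 + k1 * d2 - k2 * d1 + c1 * d2 - c2 * d1) *\<^sub>m V
      + ((l1 * d2 - l2 * d1) * s) *\<^sub>m W"
    for k1 k2 l1 l2 c1 c2 d1 d2 r s and U V W :: "complex^2^2"
    by (simp add: matrix2_eq_iff algebra_simps)
  ultimately show "field_strength A \<mu> \<nu> x =
      (wedge k c \<mu> \<nu> * ?\<rho>) *\<^sub>m R ?z
      + (wedge (cnj_vec k) c \<mu> \<nu> + wedge k d \<mu> \<nu> + wedge c d \<mu> \<nu>) *\<^sub>m Q ?z
      + (wedge (cnj_vec k) d \<mu> \<nu> * ?\<sigma>) *\<^sub>m S ?z"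
    unfolding field_strength_def D wedge_def cnj_vec_def by (simp add: add_diff_eq)
qed

text \<open>The functions \<open>r\<close> and \<open>t\<close> are independent of the indices, so
  the contraction acts on the constant forms only.\<close>

lemma component_eq:
  assumes "\<And>\<mu> \<nu>. field_strength A \<mu> \<nu> x =
      (X \<mu> \<nu> * r) *\<^sub>m R z + Y \<mu> \<nu> *\<^sub>m Q z + (Z \<mu> \<nu> * t) *\<^sub>m S z"
  shows "component A u v x = ((\<Sum>\<mu>\<in>UNIV. \<Sum>\<nu>\<in>UNIV. u $ \<mu> * v $ \<nu> * X \<mu> \<nu>) * r) *\<^sub>m R z
    + (\<Sum>\<mu>\<in>UNIV. \<Sum>\<nu>\<in>UNIV. u $ \<mu> * v $ \<nu> * Y \<mu> \<nu>) *\<^sub>m Q z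
    + ((\<Sum>\<mu>\<in>UNIV. \<Sum>\<nu>\<in>UNIV. u $ \<mu> * v $ \<nu> * Z \<mu> \<nu>) * t) *\<^sub>m S z"
  unfolding component_def assms vec_eq_iff
  by (simp only: vector_add_component smult_mat_nth sum_component sum_distrib_right
      sum.distrib[symmetric]) (intro allI sum.cong refl; simp add: algebra_simps)

lemma lagrangian_density_eq:
  assumes "\<And>\<mu> \<nu>. field_strength A \<mu> \<nu> x =
      (X \<mu> \<nu> * (- 2 * DL z / D z)) *\<^sub>m R z + Y \<mu> \<nu> *\<^sub>m Q z
      + (Z \<mu> \<nu> * (- 2 * cnj (DL z) / D z)) *\<^sub>m S z"
  shows "lagrangian_density A x =
    32 * w * cnj w / D z ^ 4 * ((\<Sum>\<mu>\<in>UNIV. \<Sum>\<nu>\<in>UNIV. X \<mu> \<nu> * Z \<mu> \<nu>) * (DL z * cnj (DL z))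
      + (\<Sum>\<mu>\<in>UNIV. \<Sum>\<nu>\<in>UNIV. (Y \<mu> \<nu>)\<^sup>2) * (w * cnj w))"
proof -
  have "trace (field_strength A \<mu> \<nu> x ** field_strength A \<mu> \<nu> x) =
    32 * w * cnj w / D z ^ 4 * (X \<mu> \<nu> * Z \<mu> \<nu> * (DL z * cnj (DL z)) + (Y \<mu> \<nu>)\<^sup>2 * (w * cnj w))" for \<mu> \<nu>
    unfolding trace_square_combination[OF assms] using D_nonzero[of z]
    by (simp add: divide_simps power2_eq_square power4_eq_xxxx) algebra
  then show ?thesis
    unfolding lagrangian_density_def
    by (simp add: sum_distrib_left sum_distrib_right sum.distrib distrib_left distrib_right)
qed

section \<open>Hyperbolic form of D and of its logarithmic derivative\<close>

lemma weights_pos: "(cmod a1)\<^sup>2 + (cmod b1)\<^sup>2 > 0" "(cmod a2)\<^sup>2 + (cmod b2)\<^sup>2 > 0"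
  using det_nonzero by (auto simp: sum_power2_gt_zero_iff)

text \<open>Multiplied out, \<open>D\<close> has coefficients \<open>e1\<close>, \<open>e1t\<close>
  at the exponentials of \<open>z + cnj z\<close> and its negative, and \<open>e2\<close>,
  \<open>cnj e2\<close> at those of \<open>z - cnj z\<close> and its negative. The logarithms in
  \<open>X1\<close> and \<open>X2\<close> balance each pair to a common modulus, giving
  \<open>cosh\<close>; the position of \<open>e2\<close> fixes the sign of \<open>z - cnj z\<close>
  in \<open>X2\<close>.\<close>

lemma hyperbolic_forms:
  fixes e1 e1t :: real and e2 X1 X2 z :: complex
  defines "e1 \<equiv> (cmod a1)\<^sup>2 + (cmod b1)\<^sup>2" and "e1t \<equiv> (cmod a2)\<^sup>2 + (cmod b2)\<^sup>2"
    and "e2 \<equiv> a1 * cnj a2 + b1 * cnj b2"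
    and "X1 \<equiv> cnj z + z + complex_of_real (ln (e1 / e1t) / 2)"
    and "X2 \<equiv> z - cnj z + log_ratio_cnj e2 / 2"
  shows "D z = 2 * (complex_of_real (sqrt (e1 * e1t)) * cosh X1 + complex_of_real (cmod e2) * cosh X2)"
    and "DL z * cnj (DL z) =
      4 * (complex_of_real (e1 * e1t) * (sinh X1)\<^sup>2 - complex_of_real ((cmod e2)\<^sup>2) * (sinh X2)\<^sup>2)"
proof -
  have pos: "e1 > 0" "e1t > 0"
    using weights_pos by (simp_all add: e1_def e1t_def)
  have half: "exp (ln y / 2) = sqrt y" "exp (- (ln y / 2)) = 1 / sqrt y" if "y > 0" for y :: real
    using that by (simp_all add: ln_sqrt[symmetric] exp_minus inverse_eq_divide)
  have "sqrt (e1 * e1t) * exp (ln (e1 / e1t) / 2) = e1"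
      "sqrt (e1 * e1t) * exp (- (ln (e1 / e1t) / 2)) = e1t"
    using pos half[of "e1 / e1t"] by (simp_all add: real_sqrt_mult real_sqrt_divide)
  then have r: "complex_of_real (sqrt (e1 * e1t)) * exp (complex_of_real (ln (e1 / e1t) / 2)) = of_real e1"
      "complex_of_real (sqrt (e1 * e1t)) * exp (- complex_of_real (ln (e1 / e1t) / 2)) = of_real e1t"
    by (simp_all only: exp_of_real of_real_mult[symmetric] of_real_minus[symmetric])
  have regroup: "c * x = e * y" if "c * h = e" "x = y * h" for c h e x y :: complex
    using that by auto
  have X1_exp: "complex_of_real (sqrt (e1 * e1t)) * exp X1 = of_real e1 * (exp z * exp (cnj z))"
      "complex_of_real (sqrt (e1 * e1t)) * exp (- X1) = of_real e1t * (exp (- z) * exp (- cnj z))"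
  proof -
    have "exp X1 = exp z * exp (cnj z) * exp (complex_of_real (ln (e1 / e1t) / 2))"
        "exp (- X1) = exp (- z) * exp (- cnj z) * exp (- complex_of_real (ln (e1 / e1t) / 2))"
      unfolding X1_def by (simp_all add: exp_add[symmetric] algebra_simps)
    then show "complex_of_real (sqrt (e1 * e1t)) * exp X1 = of_real e1 * (exp z * exp (cnj z))"
      "complex_of_real (sqrt (e1 * e1t)) * exp (- X1) = of_real e1t * (exp (- z) * exp (- cnj z))"
      using r by (auto intro: regroup)
  qed
  have half_log_ratio: "complex_of_real (cmod e2) * exp (log_ratio_cnj e2 / 2) = e2"
    "complex_of_real (cmod e2) * exp (- (log_ratio_cnj e2 / 2)) = cnj e2"
  proof -
    have "complex_of_real (cmod e2) * exp (log_ratio_cnj e2 / 2) = e2 \<and>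
      complex_of_real (cmod e2) * exp (- (log_ratio_cnj e2 / 2)) = cnj e2"
    \<comment> \<open>For \<open>e2 = 0\<close> all sides vanish, whatever value the logarithm
      takes, so the lemma also covers the degenerate case.\<close>
    proof (cases "e2 = 0")
      case False
      have "e2 * cnj e2 = complex_of_real (cmod e2) * complex_of_real (cmod e2)"
        using complex_norm_square[of e2] by (simp add: power2_eq_square)
      then have "complex_of_real (cmod e2) * inverse (e2 / complex_of_real (cmod e2)) = cnj e2"
        using False by (simp add: divide_simps) (simp add: mult.commute)
      then show ?thesis
        using False by (simp add: exp_minus exp_half_log_ratio_cnj)
    qed simp
    then show "complex_of_real (cmod e2) * exp (log_ratio_cnj e2 / 2) = e2"
      "complex_of_real (cmod e2) * exp (- (log_ratio_cnj e2 / 2)) = cnj e2" by simp_all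
  qed
  have X2_exp: "complex_of_real (cmod e2) * exp X2 = e2 * (exp z * exp (- cnj z))"
      "complex_of_real (cmod e2) * exp (- X2) = cnj e2 * (exp (- z) * exp (cnj z))"
  proof -
    have "complex_of_real (cmod e2) * exp (log_ratio_cnj e2 / 2) = e2"
        "complex_of_real (cmod e2) * exp (- (log_ratio_cnj e2 / 2)) = cnj e2"
      using half_log_ratio by simp_all
    moreover have "exp X2 = exp z * exp (- cnj z) * exp (log_ratio_cnj e2 / 2)"
        "exp (- X2) = exp (- z) * exp (cnj z) * exp (- (log_ratio_cnj e2 / 2))"
      unfolding X2_def by (simp_all add: exp_add[symmetric] algebra_simps)
    ultimately show "complex_of_real (cmod e2) * exp X2 = e2 * (exp z * exp (- cnj z))"
      "complex_of_real (cmod e2) * exp (- X2) = cnj e2 * (exp (- z) * exp (cnj z))"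
      by (auto intro: regroup)
  qed
  have e: "complex_of_real e1 = a1 * cnj a1 + b1 * cnj b1" "complex_of_real e1t = a2 * cnj a2 + b2 * cnj b2"
      "cnj e2 = cnj a1 * a2 + cnj b1 * b2"
    unfolding e1_def e1t_def e2_def by (simp_all add: complex_norm_square del: of_real_power)
  have ch: "2 * (c * cosh X) = c * exp X + c * exp (- X)" "2 * (c * sinh X) = c * exp X - c * exp (- X)"
    for c X :: complex
    by (simp_all add: cosh_field_def sinh_field_def field_simps)
  show "D z = 2 * (complex_of_real (sqrt (e1 * e1t)) * cosh X1 + complex_of_real (cmod e2) * cosh X2)"
    unfolding distrib_left ch X1_exp X2_exp e unfolding e2_def D_def p_def q_def
    by (simp add: exp_cnj algebra_simps)
  have DL: "DL z =
      2 * (complex_of_real (sqrt (e1 * e1t)) * sinh X1) + 2 * (complex_of_real (cmod e2) * sinh X2)"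
    unfolding ch X1_exp X2_exp e unfolding e2_def DL_def p_def q_def p'_def q'_def
    by (simp add: exp_cnj algebra_simps)
  \<comment> \<open>\<open>X1\<close> is real and \<open>X2\<close> is imaginary, so conjugation
    changes the sign of the second term only and the product is a difference of squares.\<close>
  have cnj_DL: "cnj (DL z) =
      2 * (complex_of_real (sqrt (e1 * e1t)) * sinh X1) - 2 * (complex_of_real (cmod e2) * sinh X2)"
    unfolding ch X1_exp X2_exp e unfolding e2_def DL_def p_def q_def p'_def q'_def
    by (simp add: exp_cnj algebra_simps)
  have sqrt: "complex_of_real (e1 * e1t) = (complex_of_real (sqrt (e1 * e1t)))\<^sup>2"
    using pos by (simp flip: of_real_power)
  show "DL z * cnj (DL z) =
      4 * (complex_of_real (e1 * e1t) * (sinh X1)\<^sup>2 - complex_of_real ((cmod e2)\<^sup>2) * (sinh X2)\<^sup>2)"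
    unfolding sqrt of_real_power cnj_DL unfolding DL by algebra
qed

text \<open>The Gram determinant of the vectors \<open>(a1, b1)\<close> and \<open>(a2, b2)\<close>.
  If they are orthogonal, \<open>\<epsilon>1 \<epsilon>1t\<close> equals the squared modulus of
  \<open>\<epsilon>0\<close>, which turns the density into its \<open>sech\<close> form.\<close>

lemma lagrange_identity:
  "complex_of_real ((cmod w)\<^sup>2) =
    complex_of_real (((cmod a1)\<^sup>2 + (cmod b1)\<^sup>2) * ((cmod a2)\<^sup>2 + (cmod b2)\<^sup>2))
    - complex_of_real ((cmod (a1 * cnj a2 + b1 * cnj b2))\<^sup>2)"
  unfolding of_real_mult of_real_add complex_norm_square w_def by (simp add: algebra_simps)

end

text \<open>Inverses and derivatives that do not exist have arbitrary values, and division by zero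
  gives zero. The conclusions on positivity, invertibility, differentiability and nonzero
  denominators therefore express that everything is well defined.\<close>

theorem mainTheorem2:
  fixes a1 a2 b1 b2 \<alpha> \<beta> lam \<epsilon>0 \<epsilon>2 :: complex
    and \<epsilon>1 \<epsilon>1t :: real
    and L X1 X2 :: "real^4 \<Rightarrow> complex"
    and \<psi> J :: "real^4 \<Rightarrow> complex^2^2"
    and \<Lambda> :: "complex^2^2"
    and A :: gauge_field
  assumes lam_nonzero: "lam \<noteq> 0"
    and \<epsilon>0_def: "\<epsilon>0 = a1 * b2 - a2 * b1"
    and \<epsilon>0_nonzero: "\<epsilon>0 \<noteq> 0"
    and L_def: "\<And>x. L x = (1 / complex_of_real (sqrt 2)) *
           ((lam * \<alpha> + \<beta>) * complex_of_real (x$1) + \<i> * (lam * \<alpha> - \<beta>) * complex_of_real (x$2)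
          + (lam * \<beta> - \<alpha>) * complex_of_real (x$3) + \<i> * (lam * \<beta> + \<alpha>) * complex_of_real (x$4))"
    and \<psi>_def: "\<And>x. \<psi> x = mat2
           (a1 * exp (L x) + a2 * exp (- L x)) (cnj b1 * exp (cnj (L x)) + cnj b2 * exp (- cnj (L x)))
           (- b1 * exp (L x) - b2 * exp (- L x)) (cnj a1 * exp (cnj (L x)) + cnj a2 * exp (- cnj (L x)))"
    and \<Lambda>_def: "\<Lambda> = mat2 lam 0 0 (- 1 / cnj lam)"
    and J_def: "\<And>x. J x = - (\<psi> x ** \<Lambda> ** matrix_inv (\<psi> x))"
    and A1_def: "\<And>x. A 1 x = (- 1/2) *\<^sub>m (partial_deriv 1 J x ** matrix_inv (J x)
                      - \<i> *\<^sub>m (partial_deriv 2 J x ** matrix_inv (J x)))"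
    and A2_def: "\<And>x. A 2 x = \<i> *\<^sub>m A 1 x"
    and A3_def: "\<And>x. A 3 x = (- 1/2) *\<^sub>m (partial_deriv 3 J x ** matrix_inv (J x)
                      - \<i> *\<^sub>m (partial_deriv 4 J x ** matrix_inv (J x)))"
    and A4_def: "\<And>x. A 4 x = \<i> *\<^sub>m A 3 x"
    and \<epsilon>1_def: "\<epsilon>1 = (cmod a1)\<^sup>2 + (cmod b1)\<^sup>2"
    and \<epsilon>1t_def: "\<epsilon>1t = (cmod a2)\<^sup>2 + (cmod b2)\<^sup>2"
    and \<epsilon>2_def: "\<epsilon>2 = a1 * cnj a2 + b1 * cnj b2"
    and X1_def: "\<And>x. X1 x = cnj (L x) + L x + complex_of_real (ln (\<epsilon>1 / \<epsilon>1t) / 2)"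
    and X2_def: "\<And>x. X2 x = L x - cnj (L x) + log_ratio_cnj \<epsilon>2 / 2"
  shows "\<epsilon>1 > 0 \<and> \<epsilon>1t > 0
    \<and> (\<forall>x. invertible (\<psi> x) \<and> invertible (J x)
          \<and> J differentiable (at x) \<and> (\<forall>\<mu>. A \<mu> differentiable (at x)))
    \<and> anti_self_dual_YM A
    \<and> (\<forall>\<mu> x. trace (A \<mu> x) = 0)
    \<and> (\<forall>x. lagrangian_density A x \<in> \<real>)
    \<and> (\<epsilon>2 \<noteq> 0 \<longrightarrow> (\<forall>x.
          complex_of_real (sqrt (\<epsilon>1 * \<epsilon>1t)) * cosh (X1 x)
            + complex_of_real (cmod \<epsilon>2) * cosh (X2 x) \<noteq> 0
        \<and> lagrangian_density A x =
            8 * (complex_of_real (((cmod \<alpha>)\<^sup>2 + (cmod \<beta>)\<^sup>2) * ((cmod lam)\<^sup>2 + 1) * cmod \<epsilon>0))\<^sup>2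
            * ((2 * complex_of_real (\<epsilon>1 * \<epsilon>1t) * (sinh (X1 x))\<^sup>2
                - 2 * complex_of_real ((cmod \<epsilon>2)\<^sup>2) * (sinh (X2 x))\<^sup>2
                - complex_of_real ((cmod \<epsilon>0)\<^sup>2))
              / (complex_of_real (sqrt (\<epsilon>1 * \<epsilon>1t)) * cosh (X1 x)
                 + complex_of_real (cmod \<epsilon>2) * cosh (X2 x)) ^ 4)))
    \<and> (\<epsilon>2 = 0 \<longrightarrow> (\<forall>x.
          cosh (X1 x) \<noteq> 0
        \<and> lagrangian_density A x =
            8 * (complex_of_real (((cmod \<alpha>)\<^sup>2 + (cmod \<beta>)\<^sup>2) * ((cmod lam)\<^sup>2 + 1) * cmod \<epsilon>0))\<^sup>2
            * ((2 * complex_of_real (\<epsilon>1 * \<epsilon>1t) * (sinh (X1 x))\<^sup>2 - complex_of_real ((cmod \<epsilon>0)\<^sup>2))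
              / (complex_of_real (sqrt (\<epsilon>1 * \<epsilon>1t)) * cosh (X1 x)) ^ 4)
        \<and> lagrangian_density A x =
            8 * (complex_of_real (((cmod \<alpha>)\<^sup>2 + (cmod \<beta>)\<^sup>2) * ((cmod lam)\<^sup>2 + 1)))\<^sup>2
            * (2 * (1 / cosh (X1 x))\<^sup>2 - 3 * (1 / cosh (X1 x)) ^ 4)))"
proof -
  interpret exponential_pair a1 a2 b1 b2
    using \<epsilon>0_def \<epsilon>0_nonzero by unfold_locales simp
  let ?k = "phase_vec lam \<alpha> \<beta>" and ?c = "R_coeff lam \<alpha> \<beta>" and ?d = "S_coeff lam \<alpha> \<beta>"
    and ?m = "lam * cnj lam + 1"
  note phase = dots_phase[OF lam_nonzero, of \<alpha> \<beta>] and frame = dots_frame[OF lam_nonzero, of \<alpha> \<beta>]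

  \<comment> \<open>The gauge potential as a combination of R and S\<close>
  have L: "L x = (\<Sum>i\<in>UNIV. ?k $ i * complex_of_real (x $ i))" for x
    by (simp add: L_def phase_vec_def sum_4 vector4_nth add_divide_distrib diff_divide_distrib)
  have psi: "\<psi> x = psi (L x)" for x
    by (simp add: \<psi>_def psi_def p_def q_def exp_cnj)
  have "J = (\<lambda>x. J_of lam (L x))"
    unfolding J_def \<Lambda>_def psi matrix_inv_eqI[OF psi_inverse]
    by (rule ext) (rule J_of_eq_conjugation[OF lam_nonzero])
  then have J: "J = (\<lambda>x. J_of lam (L x))" "J x = J_of lam (L x)" for x
    by simp_all
  note J_inv = matrix_inv_eqI[OF J_of_inverse[OF lam_nonzero]]
  have current: "partial_deriv \<mu> J x ** matrix_inv (J x) =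
      (?k $ \<mu> * ?m / (lam * cnj lam)) *\<^sub>m R (L x) + (- cnj (?k $ \<mu>) * ?m) *\<^sub>m S (L x)" for \<mu> x
    unfolding J(1) linear_phase_deriv(2)[OF L wirtinger_J] J_inv
    by (rule current_eq[OF lam_nonzero])
  have combine: "e *\<^sub>m (u1 *\<^sub>m M + v1 *\<^sub>m N - \<i> *\<^sub>m (u2 *\<^sub>m M + v2 *\<^sub>m N)) =
      (e * (u1 - \<i> * u2)) *\<^sub>m M + (e * (v1 - \<i> * v2)) *\<^sub>m N" for e u1 v1 u2 v2 M N
    by (simp add: matrix2_eq_iff algebra_simps)
  have rotate: "\<i> *\<^sub>m (u *\<^sub>m M + v *\<^sub>m N) = (\<i> * u) *\<^sub>m M + (\<i> * v) *\<^sub>m N" for u v M N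
    by (simp add: matrix2_eq_iff algebra_simps)
  \<comment> \<open>With \<open>k\<close> the gradient of \<open>L\<close>,
    \<open>k1 - \<i> k2 = sqrt 2 lam \<alpha>\<close> and
    \<open>cnj k1 - \<i> cnj k2 = sqrt 2 cnj \<beta>\<close>; for the indices 3 and 4 the values are
    \<open>sqrt 2 lam \<beta>\<close> and \<open>- sqrt 2 cnj \<alpha>\<close>.\<close>
  have coeff: "(- 1/2) * (?k $ 1 * ?m / (lam * cnj lam) - \<i> * (?k $ 2 * ?m / (lam * cnj lam))) = ?c $ 1"
      "(- 1/2) * (?k $ 3 * ?m / (lam * cnj lam) - \<i> * (?k $ 4 * ?m / (lam * cnj lam))) = ?c $ 3"
      "(- 1/2) * (- cnj (?k $ 1) * ?m - \<i> * (- cnj (?k $ 2) * ?m)) = ?d $ 1"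
      "(- 1/2) * (- cnj (?k $ 3) * ?m - \<i> * (- cnj (?k $ 4) * ?m)) = ?d $ 3"
    using lam_nonzero
    by (simp_all add: phase_vec_def R_coeff_def S_coeff_def vector4_nth field_simps)
  have rot: "\<i> * ?c $ 1 = ?c $ 2" "\<i> * ?c $ 3 = ?c $ 4" "\<i> * ?d $ 1 = ?d $ 2" "\<i> * ?d $ 3 = ?d $ 4"
    by (simp_all add: R_coeff_def S_coeff_def vector4_nth)
  have A13: "A 1 x = ?c $ 1 *\<^sub>m R (L x) + ?d $ 1 *\<^sub>m S (L x)"
      "A 3 x = ?c $ 3 *\<^sub>m R (L x) + ?d $ 3 *\<^sub>m S (L x)" for x
    unfolding A1_def A3_def current combine coeff by simp_all
  have A24: "A 2 x = ?c $ 2 *\<^sub>m R (L x) + ?d $ 2 *\<^sub>m S (L x)"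
      "A 4 x = ?c $ 4 *\<^sub>m R (L x) + ?d $ 4 *\<^sub>m S (L x)" for x
    unfolding A2_def A4_def A13 rotate rot by simp_all
  have "\<forall>\<mu>. A \<mu> = (\<lambda>x. ?c $ \<mu> *\<^sub>m R (L x) + ?d $ \<mu> *\<^sub>m S (L x))"
    unfolding forall_4 fun_eq_iff using A13 A24 by blast
  then have A: "A \<mu> = (\<lambda>x. ?c $ \<mu> *\<^sub>m R (L x) + ?d $ \<mu> *\<^sub>m S (L x))" for \<mu>
    by blast
  note F = field_strength_eq[OF L A]

  \<comment> \<open>Anti-self-duality and vanishing trace\<close>
  have asd: "anti_self_dual_YM A"
    unfolding anti_self_dual_YM_def
  proof (intro allI conjI)
    have zeroI: "(r * a) *\<^sub>m M + y *\<^sub>m N + (t * b) *\<^sub>m O' = 0"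
      if "r = 0" "y = 0" "t = 0" for r a y t b M N O'
      using that by (simp add: matrix2_eq_iff)
    \<comment> \<open>In the first component the commutator cancels the derivative terms at
      \<open>Q\<close>, as \<open>(lam * cnj lam + 1) / cnj lam = lam + 1 / cnj lam\<close>. In the
      second every term contains a vanishing component of the potential.\<close>
    show "component A frame_z frame_w x = 0" "component A frame_zt frame_wt x = 0" for x
      unfolding component_eq[OF F(2)] distrib_left sum.distrib sum_tensor_wedge frame
      using lam_nonzero by (intro zeroI; simp add: field_simps)+
    have diffI: "((r * a) *\<^sub>m M + y *\<^sub>m N + (t * b) *\<^sub>m O')
        - ((r' * a) *\<^sub>m M + y' *\<^sub>m N + (t' * b) *\<^sub>m O') = 0"
      if "r = r'" "y = y'" "t = t'" for r r' a y y' t t' b M N O'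
      using that by simp
    \<comment> \<open>The commutator drops out and the two components have the same coefficients at
      \<open>R\<close>, \<open>Q\<close> and \<open>S\<close>.\<close>
    show "component A frame_z frame_zt x - component A frame_w frame_wt x = 0" for x
      unfolding component_eq[OF F(2)] distrib_left sum.distrib sum_tensor_wedge frame
      using lam_nonzero by (intro diffI; simp add: field_simps)
  qed

  have traceless: "trace (A \<mu> x) = 0" for \<mu> x
  proof -
    have "trace (A \<mu> x) = ?c $ \<mu> * trace (R (L x)) + ?d $ \<mu> * trace (S (L x))"
      unfolding A by (simp add: trace_2 algebra_simps)
    then show ?thesis by (simp add: trace_R trace_S)
  qed

  \<comment> \<open>The Lagrangian density\<close>
  define K where "K = K_coeff lam \<alpha> \<beta>"
  note phase' = phase[folded K_def] phase[folded K_def, unfolded dot_commute[of "phase_vec _ _ _"]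
      dot_commute[of "cnj_vec _"]] phase(6)[unfolded dot_commute[of ?c]]
  \<comment> \<open>Only the product of \<open>dot (cnj_vec ?k) ?c = - K\<close> and
    \<open>dot ?k ?d = K\<close> survives in the Gram determinant.\<close>
  have XZ: "(\<Sum>\<mu>\<in>UNIV. \<Sum>\<nu>\<in>UNIV. wedge ?k ?c \<mu> \<nu> * wedge (cnj_vec ?k) ?d \<mu> \<nu>) = 2 * K\<^sup>2"
    unfolding sum_wedge_wedge by (simp add: phase' power2_eq_square)
  \<comment> \<open>The squares of the first two forms give \<open>- 2 * K\<^sup>2\<close> each; the
    third is null and all mixed products vanish.\<close>
  have YY: "(\<Sum>\<mu>\<in>UNIV. \<Sum>\<nu>\<in>UNIV. (wedge (cnj_vec ?k) ?c \<mu> \<nu> + wedge ?k ?d \<mu> \<nu> + wedge ?c ?d \<mu> \<nu>)\<^sup>2) =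
      - 4 * K\<^sup>2"
    unfolding power2_eq_square distrib_left distrib_right sum.distrib sum_wedge_wedge
    by (simp add: phase')
  have density: "lagrangian_density A x = 32 * w * cnj w / D (L x) ^ 4 *
      (2 * K\<^sup>2 * (DL (L x) * cnj (DL (L x))) + - 4 * K\<^sup>2 * (w * cnj w))" for x
    unfolding lagrangian_density_eq[OF F(2)] XZ YY ..
  have K: "K = complex_of_real (((cmod \<alpha>)\<^sup>2 + (cmod \<beta>)\<^sup>2) * ((cmod lam)\<^sup>2 + 1))"
    unfolding K_def K_coeff_def of_real_mult of_real_add complex_norm_square by simp
  have real: "lagrangian_density A x \<in> \<real>" for x
    unfolding density K Reals_cnj_iff by (simp add: cnj_D mult.commute)

  have w: "w = \<epsilon>0" "w * cnj w = complex_of_real ((cmod \<epsilon>0)\<^sup>2)"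
    by (simp_all add: w_def \<epsilon>0_def complex_norm_square del: of_real_power)
  let ?den = "\<lambda>x. complex_of_real (sqrt (\<epsilon>1 * \<epsilon>1t)) * cosh (X1 x) + complex_of_real (cmod \<epsilon>2) * cosh (X2 x)"
  have D: "D (L x) = 2 * ?den x"
    and DL: "DL (L x) * cnj (DL (L x)) =
      4 * (complex_of_real (\<epsilon>1 * \<epsilon>1t) * (sinh (X1 x))\<^sup>2 - complex_of_real ((cmod \<epsilon>2)\<^sup>2) * (sinh (X2 x))\<^sup>2)" for x
    using hyperbolic_forms[of "L x"] by (simp_all only: X1_def X2_def \<epsilon>1_def \<epsilon>1t_def \<epsilon>2_def)
  have nonzero: "?den x \<noteq> 0" for x
    using D_nonzero[of "L x"] unfolding D by (metis mult_zero_right)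
  have formula: "lagrangian_density A x =
            8 * (complex_of_real (((cmod \<alpha>)\<^sup>2 + (cmod \<beta>)\<^sup>2) * ((cmod lam)\<^sup>2 + 1) * cmod \<epsilon>0))\<^sup>2
            * ((2 * complex_of_real (\<epsilon>1 * \<epsilon>1t) * (sinh (X1 x))\<^sup>2
                - 2 * complex_of_real ((cmod \<epsilon>2)\<^sup>2) * (sinh (X2 x))\<^sup>2
                - complex_of_real ((cmod \<epsilon>0)\<^sup>2)) / ?den x ^ 4)" for x
  proof -
    \<comment> \<open>Here \<open>y\<close> is half of \<open>D\<close>, \<open>e\<close> is the
      squared modulus of \<open>\<epsilon>0\<close>, and \<open>u\<close>, \<open>v\<close> are the
      two terms in the formula for \<open>DL * cnj DL\<close>.\<close>
    have "32 * e / (2 * y) ^ 4 * (2 * K\<^sup>2 * (4 * (u - v)) + - 4 * K\<^sup>2 * e) =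
        8 * (K\<^sup>2 * e) * ((2 * u - 2 * v - e) / y ^ 4)" if "y \<noteq> 0" for e y u v
      using that by (simp add: power_mult_distrib field_simps)
    note this[OF nonzero, of "w * cnj w"]
    moreover have "K\<^sup>2 * (w * cnj w) =
      (complex_of_real (((cmod \<alpha>)\<^sup>2 + (cmod \<beta>)\<^sup>2) * ((cmod lam)\<^sup>2 + 1) * cmod \<epsilon>0))\<^sup>2"
      unfolding K w(2) by (simp add: power_mult_distrib)
    ultimately show ?thesis
      unfolding density D DL by (simp add: w(2) mult.assoc del: of_real_mult of_real_power of_real_add)
  qed

  have sech: "cosh (X1 x) \<noteq> 0 \<and> lagrangian_density A x =
            8 * (complex_of_real (((cmod \<alpha>)\<^sup>2 + (cmod \<beta>)\<^sup>2) * ((cmod lam)\<^sup>2 + 1)))\<^sup>2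
            * (2 * (1 / cosh (X1 x))\<^sup>2 - 3 * (1 / cosh (X1 x)) ^ 4)" if "\<epsilon>2 = 0" for x
  proof -
    have e: "\<epsilon>1 * \<epsilon>1t = (cmod \<epsilon>0)\<^sup>2"
      using lagrange_identity that unfolding \<epsilon>1_def \<epsilon>1t_def \<epsilon>2_def w(1)
      by (simp del: of_real_mult of_real_power of_real_add)
    have ch: "cosh (X1 x) \<noteq> 0"
      using nonzero[of x] that by auto
    have e0: "complex_of_real (cmod \<epsilon>0) \<noteq> 0"
      using \<epsilon>0_nonzero by simp
    \<comment> \<open>Here \<open>e\<close> is the modulus of \<open>\<epsilon>0\<close> and
      \<open>C = cosh X1\<close>. Replacing the squared \<open>sinh\<close> by
      \<open>C\<^sup>2 - 1\<close> makes the numerator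
      \<open>e\<^sup>2 * (2 * C\<^sup>2 - 3)\<close>, and all powers of \<open>e\<close>
      cancel.\<close>
    have "8 * (k * e)\<^sup>2 * ((2 * e\<^sup>2 * ((C::complex)\<^sup>2 - 1) - e\<^sup>2) / (e * C) ^ 4) =
        8 * k\<^sup>2 * (2 * (1 / C)\<^sup>2 - 3 * (1 / C) ^ 4)" if "e \<noteq> 0" "C \<noteq> 0" for k e C
      using that by (simp add: field_simps) algebra
    from this[OF e0 ch, of K] show ?thesis
      unfolding formula[of x] e K using ch that by (simp add: sinh_square_eq)
  qed
  have "invertible (\<psi> x)" "invertible (J x)" for x
    unfolding psi J(2) invertible_def
    using psi_inverse J_of_inverse[OF lam_nonzero] by blast+
  moreover have "J differentiable (at x)" for x
    unfolding J(1) by (rule linear_phase_deriv(1)[OF L wirtinger_J])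
  moreover have "\<epsilon>1 > 0" "\<epsilon>1t > 0"
    using weights_pos by (simp_all only: \<epsilon>1_def \<epsilon>1t_def)
  moreover have "lagrangian_density A x =
            8 * (complex_of_real (((cmod \<alpha>)\<^sup>2 + (cmod \<beta>)\<^sup>2) * ((cmod lam)\<^sup>2 + 1) * cmod \<epsilon>0))\<^sup>2
            * ((2 * complex_of_real (\<epsilon>1 * \<epsilon>1t) * (sinh (X1 x))\<^sup>2 - complex_of_real ((cmod \<epsilon>0)\<^sup>2))
              / (complex_of_real (sqrt (\<epsilon>1 * \<epsilon>1t)) * cosh (X1 x)) ^ 4)" if "\<epsilon>2 = 0" for x
    unfolding formula[of x] using that by simp
  ultimately show ?thesis
    using F(1) asd traceless real nonzero formula sech by blast
qed

end
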